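(* Let $K$ be a field of characteristic zero, let $n\ge 1$, let $R=K[x_1,\ldots,x_n]$ be the polynomial ring with $\deg x_i=1$, and let $d_1,\ldots,d_n$ be positive integers. For $n\ge 2$, let $$l_i=a_{i1}x_1+a_{i2}x_2+\cdots+a_{i,i+1}x_{i+1}\quad (i=1,\ldots,n-1),\qquad l_n=a_{n1}x_1+\cdots+a_{nn}x_n,$$ with $a_{ij}\in K$, and let $I=(x_1^{d_1}l_1,\,x_2^{d_2}l_2,\ldots,x_n^{d_n}l_n)\subset R$; assume that $I$ is an Artinian complete intersection ideal (i.e. $R/I$ is finite-dimensional over $K$). For $n=1$, put $I=(x_1^{d_1+1})\subset K[x_1]$. Then $A=R/I$ has the strong Lefschetz property.
   Context: A standard graded Artinian $K$-algebra is $A=\bigoplus_{i=0}^c A_i$ with $A_0=K$, generated by $A_1$, finite-dimensional, and $A_c\neq 0$. $A$ has the strong Lefschetz property (SLP) if there exists a linear form $z\in A_1$ such that the multiplication map $\times z^d: A_i\to A_{i+d}$ has full rank (i.e. is injective or surjective) for all $1\le d\le c-1$ and $0\le i\le c-d$; such $z$ is called a strong Lefschetz (SL) element. *)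

theory Defs
  imports "HOL-Library.Poly_Mapping"
begin

(* Multivariate polynomials over K: finitely supported maps from monomials
(exponent vectors nat => nat) to coefficients, with convolution product.
Variables are indexed from 0, so x_1..x_n of the paper are Var 0 .. Var (n-1). *)

type_synonym 'k mpoly = "(nat \<Rightarrow>\<^sub>0 nat) \<Rightarrow>\<^sub>0 'k"

definition Var :: "nat \<Rightarrow> 'k::comm_ring_1 mpoly" where
  "Var i = Poly_Mapping.single (Poly_Mapping.single i 1) 1"

definition Const :: "'k::comm_ring_1 \<Rightarrow> 'k mpoly" where
  "Const c = Poly_Mapping.single 0 c"

definition mdeg :: "(nat \<Rightarrow>\<^sub>0 nat) \<Rightarrow> nat" where
  "mdeg m = (\<Sum>i\<in>Poly_Mapping.keys m. Poly_Mapping.lookup m i)"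

definition polyring :: "nat \<Rightarrow> 'k::comm_ring_1 mpoly set" where
  "polyring n = {p. \<forall>m\<in>Poly_Mapping.keys p. \<forall>i\<in>Poly_Mapping.keys m. i < n}"

definition homog :: "nat \<Rightarrow> nat \<Rightarrow> 'k::comm_ring_1 mpoly set" where
  "homog n j = {p \<in> polyring n. \<forall>m\<in>Poly_Mapping.keys p. mdeg m = j}"

definition gen_ideal :: "nat \<Rightarrow> (nat \<Rightarrow> 'k::comm_ring_1 mpoly) \<Rightarrow> 'k mpoly set" where
  "gen_ideal n g = {p. \<exists>q. (\<forall>i<n. q i \<in> polyring n) \<and> p = (\<Sum>i<n. q i * g i)}"

definition artinian_quot :: "nat \<Rightarrow> 'k::comm_ring_1 mpoly set \<Rightarrow> bool" where
  "artinian_quot n I \<longleftrightarrow> (\<exists>B. finite B \<and> B \<subseteq> polyring n \<and>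
      (\<forall>p\<in>polyring n. \<exists>c. p - (\<Sum>b\<in>B. Const (c b) * b) \<in> I))"

definition socle_deg :: "nat \<Rightarrow> 'k::comm_ring_1 mpoly set \<Rightarrow> nat" where
  "socle_deg n I = (GREATEST j. \<exists>f\<in>homog n j. f \<notin> I)"

(* The multiplication map by z^d : A_i \<rightarrow> A_(i+d), induced on the graded pieces
A_j = R_j / (I \<inter> R_j), is injective resp. surjective. *)
definition mult_inj :: "nat \<Rightarrow> 'k::comm_ring_1 mpoly set \<Rightarrow> 'k mpoly \<Rightarrow> nat \<Rightarrow> nat \<Rightarrow> bool" where
  "mult_inj n I z d i \<longleftrightarrow> (\<forall>f\<in>homog n i. z ^ d * f \<in> I \<longrightarrow> f \<in> I)"

definition mult_surj :: "nat \<Rightarrow> 'k::comm_ring_1 mpoly set \<Rightarrow> 'k mpoly \<Rightarrow> nat \<Rightarrow> nat \<Rightarrow> bool" where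
  "mult_surj n I z d i \<longleftrightarrow> (\<forall>g\<in>homog n (i + d). \<exists>f\<in>homog n i. g - z ^ d * f \<in> I)"

definition SLP :: "nat \<Rightarrow> 'k::comm_ring_1 mpoly set \<Rightarrow> bool" where
  "SLP n I \<longleftrightarrow> (let c = socle_deg n I in
     \<exists>z\<in>homog n 1. \<forall>d i. 1 \<le> d \<and> d \<le> c - 1 \<and> i \<le> c - d \<longrightarrow>
        mult_inj n I z d i \<or> mult_surj n I z d i)"

definition lform :: "nat \<Rightarrow> (nat \<Rightarrow> nat \<Rightarrow> 'k::comm_ring_1) \<Rightarrow> nat \<Rightarrow> 'k mpoly" where
  "lform n a i = (\<Sum>j\<le>min (i + 1) (n - 1). Const (a i j) * Var j)"

definition gens :: "nat \<Rightarrow> (nat \<Rightarrow> nat) \<Rightarrow> (nat \<Rightarrow> nat \<Rightarrow> 'k::comm_ring_1) \<Rightarrow> nat \<Rightarrow> 'k mpoly" where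
  "gens n d a i = (if n = 1 then Var 0 ^ (d 0 + 1) else Var i ^ d i * lform n a i)"

end

theory Submission
  imports Defs "HOL-Computational_Algebra.Polynomial"
begin

text \<open>Let \<open>z = x\<^sub>1\<close> and \<open>D\<^sub>j = d\<^sub>1 + \<dots> + d\<^bsub>j-1\<^esub>\<close>. Because \<open>l\<^sub>j\<close> involves only one new variable,
  \<open>z\<close> to the power \<open>D\<^sub>j\<close> times \<open>x\<^sub>j - \<alpha>\<^sub>j z\<close> lies in \<open>I\<close> for some \<open>\<alpha>\<^sub>j \<noteq> 0\<close>, as long as the coefficients
  of the new variables do not vanish.
  Hence the ring graded by the \<open>z\<close>-adic filtration is filtered by modules \<open>U \<otimes> K[w]/(w\<^sup>D)\<close>
  (\<open>w\<close> the class of \<open>z\<close>), where \<open>U = x\<^sub>j C\<close> and \<open>C\<close> is the quotient by an ideal of the same kind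
  in the variables from \<open>x\<^sub>j\<close> on; so \<open>U\<close> is a quotient of the algebra in which \<open>d\<^sub>j\<close> is decreased
  by one. By induction a form \<open>y\<close> in the other variables has the surjectivity half of the Lefschetz
  property on each \<open>U\<close>, and in characteristic zero \<open>y + w\<close> inherits it on \<open>U \<otimes> K[w]/(w\<^sup>D)\<close>:
  a sequence killed by the \<open>N\<close>-th power of \<open>1 + shift\<close> is an alternating polynomial of degree less
  than \<open>N\<close> and vanishes if it has \<open>N\<close> zeros. Surjectivity is an open condition, so it passes from
  the graded ring to \<open>y + t z\<close> on \<open>R/I\<close> for all but finitely many \<open>t\<close>. Injectivity follows from
  surjectivity because \<open>R/I\<close> is Gorenstein: its socle is computed by splitting off the factors
  \<open>x\<^sub>i\<close> and \<open>l\<^sub>i\<close>, every choice of which is a regular sequence of linear forms.\<close>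

section \<open>Forms and ideals in the polynomial ring\<close>

lemma Const_simps [simp]:
  "Const 0 = 0" "Const 1 = 1"
  by (simp_all add: Const_def)

lemma Const_add: "Const (a + b) = Const a + Const b"
  by (simp add: Const_def single_add)

lemma Const_diff: "Const (a - b) = Const a - Const b"
  by (simp add: Const_def single_diff)

lemma Const_uminus: "Const (- a) = - Const a"
  by (simp add: Const_def single_uminus)

lemma Const_mult: "Const (a * b) = Const a * Const b"
  by (simp add: Const_def mult_single)

lemma Const_power: "Const (a ^ k) = Const a ^ k"
  by (induction k) (simp_all add: Const_mult)

lemma Const_sum: "Const (\<Sum>x\<in>X. f x) = (\<Sum>x\<in>X. Const (f x))"
  by (induction X rule: infinite_finite_induct) (simp_all add: Const_add)

lemma Const_inverse_mult: "c \<noteq> 0 \<Longrightarrow> Const (inverse c) * (Const c * p) = p" for c :: "'k::field"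
  by (simp add: mult.assoc [symmetric] Const_mult [symmetric])

interpretation mp: vector_space "\<lambda>c p. Const c * p :: 'k::field mpoly"
  by unfold_locales (simp_all add: algebra_simps Const_add Const_mult)

interpretation mpp: vector_space "\<lambda>c p. smult (Const c) p :: 'k::field mpoly poly"
  by unfold_locales (simp_all add: smult_add_right smult_add_left Const_add Const_mult)

text \<open>As simp rules these fold products of constants and would work against rewriting with
  \<open>Const_mult\<close>.\<close>

declare mp.scale_scale [simp del] mpp.scale_scale [simp del]

lemma mpoly_sum_single:
  "p = (\<Sum>m\<in>Poly_Mapping.keys p. Poly_Mapping.single m (Poly_Mapping.lookup p m))"
  by (rule poly_mapping_eqI) (auto simp: lookup_sum lookup_single when_def in_keys_iff)

lemma single_eq_Const_mult: "Poly_Mapping.single m c = Const c * Poly_Mapping.single m 1"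
  by (simp add: Const_def mult_single)

lemma mdeg_superset:
  assumes "finite S" "Poly_Mapping.keys m \<subseteq> S"
  shows "mdeg m = (\<Sum>i\<in>S. Poly_Mapping.lookup m i)"
  unfolding mdeg_def using assms by (intro sum.mono_neutral_left) (auto simp: in_keys_iff)

lemma mdeg_add: "mdeg (m + m') = mdeg m + mdeg m'"
proof -
  let ?S = "Poly_Mapping.keys m \<union> Poly_Mapping.keys m'"
  have "mdeg (m + m') = (\<Sum>i\<in>?S. Poly_Mapping.lookup (m + m') i)"
    by (rule mdeg_superset) (use keys_add [of m m'] in auto)
  then show ?thesis
    by (simp add: lookup_add sum.distrib mdeg_superset [of ?S m] mdeg_superset [of ?S m'])
qed

lemma mdeg_0 [simp]: "mdeg 0 = 0"
  by (simp add: mdeg_def)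

lemma mdeg_single [simp]: "mdeg (Poly_Mapping.single i k) = k"
  by (simp add: mdeg_def)

lemma keys_add_nat: "Poly_Mapping.keys (m + m') = Poly_Mapping.keys m \<union> Poly_Mapping.keys m'"
  for m m' :: "'a \<Rightarrow>\<^sub>0 nat"
  by (auto simp: in_keys_iff lookup_add)

lemma polyring_0 [simp]: "0 \<in> polyring n"
  by (simp add: polyring_def)

lemma polyring_Const [simp]: "Const c \<in> polyring n"
  by (simp add: polyring_def Const_def)

lemma polyring_1 [simp]: "1 \<in> polyring n"
  using polyring_Const [of 1] by simp

lemma polyring_Var [simp]: "i < n \<Longrightarrow> Var i \<in> polyring n"
  by (simp add: polyring_def Var_def)

lemma polyring_add: "p \<in> polyring n \<Longrightarrow> q \<in> polyring n \<Longrightarrow> p + q \<in> polyring n"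
  using keys_add [of p q] by (auto simp: polyring_def)

lemma polyring_uminus: "p \<in> polyring n \<Longrightarrow> - p \<in> polyring n"
  by (auto simp: polyring_def in_keys_iff)

lemma polyring_diff: "p \<in> polyring n \<Longrightarrow> q \<in> polyring n \<Longrightarrow> p - q \<in> polyring n"
  using polyring_add [of p n "- q"] polyring_uminus [of q n] by simp

lemma polyring_mult: "p \<in> polyring n \<Longrightarrow> q \<in> polyring n \<Longrightarrow> p * q \<in> polyring n"
  using keys_mult [of p q] by (fastforce simp: polyring_def keys_add_nat)

lemma polyring_sum: "(\<And>x. x \<in> X \<Longrightarrow> f x \<in> polyring n) \<Longrightarrow> (\<Sum>x\<in>X. f x) \<in> polyring n"
  by (induction X rule: infinite_finite_induct) (auto intro: polyring_add)

lemma polyring_power: "p \<in> polyring n \<Longrightarrow> p ^ k \<in> polyring n"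
  by (induction k) (auto intro: polyring_mult)

lemmas polyring_intros = polyring_add polyring_diff polyring_mult polyring_sum polyring_power
  polyring_uminus

lemma homog_polyring: "p \<in> homog n j \<Longrightarrow> p \<in> polyring n"
  by (simp add: homog_def)

lemma homog_0 [simp]: "0 \<in> homog n j"
  by (simp add: homog_def)

lemma homog_add: "p \<in> homog n j \<Longrightarrow> q \<in> homog n j \<Longrightarrow> p + q \<in> homog n j"
  using keys_add [of p q] by (auto simp: homog_def intro: polyring_add)

lemma homog_uminus: "p \<in> homog n j \<Longrightarrow> - p \<in> homog n j"
  by (auto simp: homog_def polyring_uminus in_keys_iff)

lemma homog_diff: "p \<in> homog n j \<Longrightarrow> q \<in> homog n j \<Longrightarrow> p - q \<in> homog n j"
  using homog_add [of p n j "- q"] homog_uminus [of q n j] by simp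

lemma homog_sum: "(\<And>x. x \<in> X \<Longrightarrow> f x \<in> homog n j) \<Longrightarrow> (\<Sum>x\<in>X. f x) \<in> homog n j"
  by (induction X rule: infinite_finite_induct) (auto intro: homog_add)

lemma homog_mult: "p \<in> homog n i \<Longrightarrow> q \<in> homog n j \<Longrightarrow> p * q \<in> homog n (i + j)"
  using keys_mult [of p q] by (fastforce simp: homog_def mdeg_add intro: polyring_mult)

lemma homog_mult': "p \<in> homog n i \<Longrightarrow> q \<in> homog n j \<Longrightarrow> k = i + j \<Longrightarrow> p * q \<in> homog n k"
  by (simp add: homog_mult)

lemma homog_Const [simp]: "Const c \<in> homog n 0"
  by (simp add: homog_def) (simp add: Const_def)

lemma homog_Const_mult: "p \<in> homog n j \<Longrightarrow> Const c * p \<in> homog n j"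
  using homog_mult [OF homog_Const, of p n j c] by simp

lemma homog_1 [simp]: "1 \<in> homog n 0"
  using homog_Const [of 1] by simp

lemma homog_Var [simp]: "i < n \<Longrightarrow> Var i \<in> homog n 1"
  by (simp add: homog_def) (simp add: Var_def)

lemma homog_power: "p \<in> homog n i \<Longrightarrow> p ^ k \<in> homog n (i * k)"
  by (induction k) (auto intro: homog_mult)

lemma homog_power1: "p \<in> homog n 1 \<Longrightarrow> p ^ k \<in> homog n k"
  using homog_power [of p n 1 k] by simp

lemma homog_power_mult:
  "p \<in> homog n 1 \<Longrightarrow> q \<in> homog n i \<Longrightarrow> j = k + i \<Longrightarrow> p ^ k * q \<in> homog n j"
  by (metis homog_mult homog_power1)

section \<open>Homogeneous components\<close>

definition hcomp :: "nat \<Rightarrow> 'k::comm_ring_1 mpoly \<Rightarrow> 'k mpoly" where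
  "hcomp a p = (\<Sum>m\<in>{m\<in>Poly_Mapping.keys p. mdeg m = a}.
     Poly_Mapping.single m (Poly_Mapping.lookup p m))"

lemma lookup_hcomp:
  "Poly_Mapping.lookup (hcomp a p) m = (if mdeg m = a then Poly_Mapping.lookup p m else 0)"
  by (auto simp: hcomp_def lookup_sum lookup_single when_def in_keys_iff)

lemma hcomp_add: "hcomp a (p + q) = hcomp a p + hcomp a q"
  by (rule poly_mapping_eqI) (simp add: lookup_hcomp lookup_add)

lemma hcomp_diff: "hcomp a (p - q) = hcomp a p - hcomp a q"
  by (rule poly_mapping_eqI) (simp add: lookup_hcomp lookup_minus)

lemma hcomp_0 [simp]: "hcomp a 0 = 0"
  by (rule poly_mapping_eqI) (simp add: lookup_hcomp)

lemma hcomp_sum: "hcomp a (\<Sum>x\<in>X. f x) = (\<Sum>x\<in>X. hcomp a (f x))"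
  by (induction X rule: infinite_finite_induct) (simp_all add: hcomp_add)

lemma hcomp_homog: "p \<in> homog n b \<Longrightarrow> hcomp a p = (if a = b then p else 0)"
  by (rule poly_mapping_eqI) (auto simp: lookup_hcomp homog_def in_keys_iff)

lemma hcomp_in_homog: "p \<in> polyring n \<Longrightarrow> hcomp a p \<in> homog n a"
  by (auto simp: homog_def polyring_def in_keys_iff lookup_hcomp split: if_splits)

lemma sum_hcomp:
  assumes "p \<in> polyring n"
  shows "p = (\<Sum>a\<in>mdeg ` Poly_Mapping.keys p. hcomp a p)"
  by (rule poly_mapping_eqI) (auto simp: lookup_sum lookup_hcomp in_keys_iff)

text \<open>Multiplication by a form of degree \<open>b\<close> shifts every component by
  \<open>b\<close>; the guard stands for the absent components of negative degree.\<close>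

lemma hcomp_mult_homog:
  assumes "q \<in> polyring n" "g \<in> homog n b"
  shows "hcomp a (q * g) = (if b \<le> a then hcomp (a - b) q * g else 0)"
proof -
  have "q * g = (\<Sum>c\<in>mdeg ` Poly_Mapping.keys q. hcomp c q * g)"
    by (subst sum_hcomp [OF assms(1)]) (simp add: sum_distrib_right)
  then have "hcomp a (q * g) =
      (\<Sum>c\<in>mdeg ` Poly_Mapping.keys q. hcomp a (hcomp c q * g))"
    by (simp add: hcomp_sum)
  also have "\<dots> = (\<Sum>c\<in>mdeg ` Poly_Mapping.keys q.
      if c = a - b \<and> b \<le> a then hcomp (a - b) q * g else 0)"
  proof (intro sum.cong refl)
    fix c
    show "hcomp a (hcomp c q * g) = (if c = a - b \<and> b \<le> a then hcomp (a - b) q * g else 0)"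
      using hcomp_homog [OF homog_mult [OF hcomp_in_homog [OF assms(1)] assms(2)], of a c] by auto
  qed
  also have "\<dots> = (if b \<le> a then hcomp (a - b) q * g else 0)"
  proof (cases "a - b \<in> mdeg ` Poly_Mapping.keys q")
    case False
    then have "hcomp (a - b) q = 0"
      by (intro poly_mapping_eqI) (metis image_eqI in_keys_iff lookup_hcomp lookup_zero)
    then show ?thesis by simp
  qed auto
  finally show ?thesis .
qed

section \<open>Ideals with finitely many generators\<close>

lemma gen_ideal_polyring:
  "(\<And>i. i < n \<Longrightarrow> g i \<in> polyring n) \<Longrightarrow> p \<in> gen_ideal n g \<Longrightarrow> p \<in> polyring n"
  by (auto simp: gen_ideal_def intro!: polyring_intros)

lemma gen_ideal_0 [simp]: "0 \<in> gen_ideal n g"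
  unfolding gen_ideal_def by (rule CollectI, rule exI [of _ "\<lambda>_. 0"]) simp

lemma gen_ideal_add: "p \<in> gen_ideal n g \<Longrightarrow> q \<in> gen_ideal n g \<Longrightarrow> p + q \<in> gen_ideal n g"
proof -
  assume "p \<in> gen_ideal n g" "q \<in> gen_ideal n g"
  then obtain u v where "\<forall>i<n. u i \<in> polyring n" "p = (\<Sum>i<n. u i * g i)"
      "\<forall>i<n. v i \<in> polyring n" "q = (\<Sum>i<n. v i * g i)"
    by (auto simp: gen_ideal_def)
  then show ?thesis unfolding gen_ideal_def
    by (intro CollectI exI [of _ "\<lambda>i. u i + v i"])
       (auto simp: algebra_simps sum.distrib intro: polyring_add)
qed

lemma gen_ideal_mult: "p \<in> gen_ideal n g \<Longrightarrow> r \<in> polyring n \<Longrightarrow> r * p \<in> gen_ideal n g"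
proof -
  assume "p \<in> gen_ideal n g" and r: "r \<in> polyring n"
  then obtain u where "\<forall>i<n. u i \<in> polyring n" "p = (\<Sum>i<n. u i * g i)"
    by (auto simp: gen_ideal_def)
  with r show ?thesis unfolding gen_ideal_def
    by (intro CollectI exI [of _ "\<lambda>i. r * u i"])
       (auto simp: sum_distrib_left mult.assoc intro: polyring_mult)
qed

lemma gen_ideal_mult': "p \<in> gen_ideal n g \<Longrightarrow> r \<in> polyring n \<Longrightarrow> p * r \<in> gen_ideal n g"
  using gen_ideal_mult by (metis mult.commute)

lemma gen_ideal_Const: "p \<in> gen_ideal n g \<Longrightarrow> Const c * p \<in> gen_ideal n g"
  by (simp add: gen_ideal_mult)

lemma gen_ideal_uminus: "p \<in> gen_ideal n g \<Longrightarrow> - p \<in> gen_ideal n g"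
  using gen_ideal_Const [of p n g "- 1"] by (simp add: Const_uminus)

lemma gen_ideal_diff: "p \<in> gen_ideal n g \<Longrightarrow> q \<in> gen_ideal n g \<Longrightarrow> p - q \<in> gen_ideal n g"
  using gen_ideal_add [of p n g "- q"] gen_ideal_uminus [of q n g] by simp

lemma gen_ideal_sum:
  "(\<And>x. x \<in> X \<Longrightarrow> f x \<in> gen_ideal n g) \<Longrightarrow> (\<Sum>x\<in>X. f x) \<in> gen_ideal n g"
  by (induction X rule: infinite_finite_induct) (auto intro: gen_ideal_add)

lemma gen_ideal_gen: "i < n \<Longrightarrow> g i \<in> gen_ideal n g"
  unfolding gen_ideal_def
  by (rule CollectI, rule exI [of _ "\<lambda>j. if j = i then 1 else 0"])
     (auto simp: if_distrib [where f = "\<lambda>x. x * _"] cong: if_cong)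

lemma gen_ideal_cancel_add:
  assumes "p - q \<in> gen_ideal n g"
  shows "p \<in> gen_ideal n g \<longleftrightarrow> q \<in> gen_ideal n g"
  using gen_ideal_add [OF assms, of q] gen_ideal_diff [OF _ assms, of p] by auto

lemma subspace_gen_ideal: "mp.subspace (gen_ideal n g)" for n
  by (rule mp.subspaceI) (auto intro: gen_ideal_add gen_ideal_Const)

lemma gen_ideal_mono:
  assumes "\<And>i. i < n \<Longrightarrow> g i \<in> gen_ideal n h"
  shows "gen_ideal n g \<subseteq> gen_ideal n h"
proof
  fix p assume "p \<in> gen_ideal n g"
  then obtain u where "\<forall>i<n. u i \<in> polyring n" "p = (\<Sum>i<n. u i * g i)"
    by (auto simp: gen_ideal_def)
  with assms show "p \<in> gen_ideal n h"
    by (auto intro!: gen_ideal_sum gen_ideal_mult)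
qed

text \<open>Components can be taken in each summand \<open>u i * g i\<close> separately, where the
  homogeneous generator remains a factor.\<close>

lemma gen_ideal_hcomp:
  assumes "\<And>i. i < n \<Longrightarrow> \<exists>b. g i \<in> homog n b" "p \<in> gen_ideal n g"
  shows "hcomp a p \<in> gen_ideal n g"
proof -
  obtain u where u: "\<forall>i<n. u i \<in> polyring n" "p = (\<Sum>i<n. u i * g i)"
    using assms(2) by (auto simp: gen_ideal_def)
  have "hcomp a (u i * g i) \<in> gen_ideal n g" if i: "i < n" for i
  proof -
    obtain b where b: "g i \<in> homog n b" using assms(1) i by blast
    have "hcomp c (u i) \<in> polyring n" for c
      using u i hcomp_in_homog homog_polyring by blast
    then show ?thesis
      using i by (auto simp: hcomp_mult_homog [OF u(1) [rule_format, OF i] b]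
        intro: gen_ideal_mult gen_ideal_gen)
  qed
  then show ?thesis by (auto simp: u(2) hcomp_sum intro!: gen_ideal_sum)
qed

section \<open>Linear forms and monomials of fixed degree\<close>

definition lin :: "nat \<Rightarrow> (nat \<Rightarrow> 'k::comm_ring_1) \<Rightarrow> 'k mpoly" where
  "lin n s = (\<Sum>i<n. Const (s i) * Var i)"

lemma lin_homog [simp]: "lin n s \<in> homog n 1"
  unfolding lin_def by (intro homog_sum homog_Const_mult homog_Var) auto

lemma lin_polyring [simp]: "lin n s \<in> polyring n"
  by (rule homog_polyring [OF lin_homog])

lemma lin_scale: "lin n (\<lambda>i. c * s i) = Const c * lin n s"
  by (simp add: lin_def Const_mult algebra_simps sum_distrib_left)

lemma lin_diff: "lin n (\<lambda>i. s i - t i) = lin n s - lin n t"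
  by (simp add: lin_def Const_diff algebra_simps sum_subtractf)

lemma lin_upd: "m < n \<Longrightarrow> lin n (s(m := t)) = lin n (s(m := 0)) + Const t * Var m"
  by (auto simp: lin_def sum.remove [of "{..<n}" m] intro!: sum.cong)

lemma lin_unit: "i < n \<Longrightarrow> lin n (\<lambda>j. if j = i then c else 0) = Const c * Var i"
  by (simp add: lin_def if_distrib [where f = "\<lambda>x. Const x * _"] cong: if_cong)

definition mons :: "nat \<Rightarrow> nat \<Rightarrow> (nat \<Rightarrow>\<^sub>0 nat) set" where
  "mons n a = {m. Poly_Mapping.keys m \<subseteq> {..<n} \<and> mdeg m = a}"

lemma finite_mons: "finite (mons n a)"
proof (rule finite_subset)
  let ?F = "{f. \<forall>i. (i \<in> {..<n} \<longrightarrow> f i \<in> {..a}) \<and> (i \<notin> {..<n} \<longrightarrow> f i = 0)}"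
  show "mons n a \<subseteq> Poly_Mapping.lookup -` ?F"
  proof
    fix m assume m: "m \<in> mons n a"
    then have "mdeg m = (\<Sum>i<n. Poly_Mapping.lookup m i)" "mdeg m = a"
      by (auto simp: mons_def intro: mdeg_superset)
    then have "Poly_Mapping.lookup m i \<le> a" if "i < n" for i
      using member_le_sum [of i "{..<n}" "Poly_Mapping.lookup m"] that by auto
    with m show "m \<in> Poly_Mapping.lookup -` ?F"
      by (auto simp: mons_def in_keys_iff)
  qed
  have "finite ?F" by (rule finite_set_of_finite_funs) auto
  then show "finite (Poly_Mapping.lookup -` ?F)"
    by (rule finite_vimageI) (auto intro: injI poly_mapping_eqI)
qed

lemma homog_sum_mons:
  assumes "p \<in> homog n a"
  shows "p = (\<Sum>m\<in>mons n a. Const (Poly_Mapping.lookup p m) * Poly_Mapping.single m 1)"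
proof -
  have "Poly_Mapping.keys p \<subseteq> mons n a"
    using assms by (auto simp: homog_def polyring_def mons_def)
  then have "(\<Sum>m\<in>mons n a. Poly_Mapping.single m (Poly_Mapping.lookup p m)) =
      (\<Sum>m\<in>Poly_Mapping.keys p. Poly_Mapping.single m (Poly_Mapping.lookup p m))"
    by (intro sum.mono_neutral_right finite_mons) (auto simp: in_keys_iff)
  with mpoly_sum_single [of p] show ?thesis
    by (simp add: single_eq_Const_mult [symmetric])
qed

lemma mons_homog: "m \<in> mons n a \<Longrightarrow> Poly_Mapping.single m 1 \<in> homog n a"
  by (auto simp: mons_def homog_def polyring_def split: if_splits)

text \<open>A monomial of positive degree is divisible by a variable. This carries the vanishing of
  one graded piece of a quotient to the next degree.\<close>

lemma homog_Suc_induct: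
  assumes "p \<in> homog n (Suc a)"
    and V: "\<And>i q. i < n \<Longrightarrow> q \<in> homog n a \<Longrightarrow> Var i * q \<in> Q"
    and Q: "mp.subspace Q"
  shows "p \<in> (Q :: 'k::field mpoly set)"
proof -
  have "Poly_Mapping.single m 1 \<in> Q" if m: "m \<in> mons n (Suc a)" for m
  proof -
    have "mdeg m \<noteq> 0" using m by (auto simp: mons_def)
    then obtain i where i: "i \<in> Poly_Mapping.keys m" by (auto simp: mdeg_def)
    define m' where "m' = m - Poly_Mapping.single i 1"
    have eq: "m = Poly_Mapping.single i 1 + m'"
      using i by (intro poly_mapping_eqI)
        (auto simp: m'_def lookup_add lookup_minus lookup_single when_def in_keys_iff)
    have "mdeg m = Suc (mdeg m')" "Poly_Mapping.keys m' \<subseteq> Poly_Mapping.keys m"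
      using mdeg_add [of "Poly_Mapping.single i 1" m']
        keys_add_nat [of "Poly_Mapping.single i 1" m']
      unfolding eq [symmetric] by auto
    then have "m' \<in> mons n a"
      using m by (auto simp: mons_def)
    moreover have "i < n" using i m by (auto simp: mons_def)
    moreover have "Poly_Mapping.single m 1 = Var i * Poly_Mapping.single m' (1::'k)"
      by (subst eq) (simp add: Var_def mult_single)
    ultimately show ?thesis using V mons_homog by metis
  qed
  then show ?thesis
    by (subst homog_sum_mons [OF assms(1)])
       (auto intro!: mp.subspace_sum [OF Q] mp.subspace_scale [OF Q])
qed

section \<open>Linear algebra modulo a subspace\<close>

text \<open>Induction on the nodes: p = p(b0) + (X - b0) q, and the weights for the other nodes
  apply to q. The weights do not depend on p, so they can also be used for polynomials with vector
  coefficients.\<close>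

lemma interpolation_weights:
  fixes Z :: "'k::field set"
  assumes "finite Z"
  shows "\<exists>w. \<forall>p. Polynomial.degree p < card Z \<longrightarrow> poly p c = (\<Sum>b\<in>Z. w b * poly p b)"
  using assms
proof (induction Z)
  case (insert b0 Z)
  then obtain w where w:
    "\<And>p. Polynomial.degree p < card Z \<Longrightarrow> poly p c = (\<Sum>b\<in>Z. w b * poly p b)" by blast
  define w' where "w' b = (if b = b0 then 1 - (c - b0) * (\<Sum>b\<in>Z. w b / (b - b0))
    else (c - b0) * w b / (b - b0))" for b
  have "poly p c = (\<Sum>b\<in>insert b0 Z. w' b * poly p b)"
    if p: "Polynomial.degree p < card (insert b0 Z)" for p
  proof -
    define q where "q = synthetic_div p b0"
    have pq: "poly p x = poly p b0 + (x - b0) * poly q x" for x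
      using arg_cong [OF synthetic_div_correct' [of b0 p], of "\<lambda>p. poly p x"]
      by (simp add: q_def algebra_simps)
    \<comment> \<open>Constant \<open>p\<close> is separate: if \<open>Z\<close> is empty, the
      quotient 0 still has degree 0, which is not below \<open>card Z\<close>.\<close>
    have qc: "poly q c = (\<Sum>b\<in>Z. w b * poly q b)"
    proof (cases "Polynomial.degree p = 0")
      case True
      then have "q = 0" by (simp add: q_def synthetic_div_eq_0_iff)
      then show ?thesis by simp
    next
      case False
      then have "Polynomial.degree q < card Z"
        using p insert.hyps by (simp add: q_def degree_synthetic_div)
      then show ?thesis by (rule w)
    qed
    have "(\<Sum>b\<in>Z. w' b * poly p b) =
        (\<Sum>b\<in>Z. (c - b0) * (w b / (b - b0)) * poly p b0 + (c - b0) * (w b * poly q b))"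
    proof (intro sum.cong refl)
      fix b assume "b \<in> Z"
      then have "b \<noteq> b0" using insert.hyps by auto
      then show "w' b * poly p b =
          (c - b0) * (w b / (b - b0)) * poly p b0 + (c - b0) * (w b * poly q b)"
        by (subst pq) (simp add: w'_def field_simps)
    qed
    also have "\<dots> = (c - b0) * (\<Sum>b\<in>Z. w b / (b - b0)) * poly p b0 + (c - b0) * poly q c"
      by (simp add: sum.distrib sum_distrib_left sum_distrib_right qc)
    finally have "(\<Sum>b\<in>insert b0 Z. w' b * poly p b) =
        (1 - (c - b0) * (\<Sum>b\<in>Z. w b / (b - b0))) * poly p b0 +
        ((c - b0) * (\<Sum>b\<in>Z. w b / (b - b0)) * poly p b0 + (c - b0) * poly q c)"
      using insert.hyps by (simp add: w'_def [of b0])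
    also have "\<dots> = poly p c"
      by (subst pq [of c]) (simp add: algebra_simps)
    finally show ?thesis ..
  qed
  then show ?case by blast
qed auto

text \<open>The polynomial is X (X - 1) ... (X - k + 1) / k!; characteristic zero permits the
  division.\<close>

lemma binomial_as_poly:
  "\<exists>p :: 'k::field_char_0 poly. Polynomial.degree p \<le> k \<and> (\<forall>a. poly p (of_nat a) = of_nat (a choose k))"
proof (intro exI conjI allI)
  let ?p = "smult (inverse (fact k)) (\<Prod>i<k. [:- of_nat i, 1 :: 'k:])"
  have "Polynomial.degree (\<Prod>i<k. [:- of_nat i, 1 :: 'k:]) \<le> (\<Sum>i<k. 1)"
    by (rule order.trans [OF degree_prod_sum_le]) (auto intro: sum_mono)
  then show "Polynomial.degree ?p \<le> k"
    using degree_smult_le [of "inverse (fact k)" "\<Prod>i<k. [:- of_nat i, 1 :: 'k:]"] by simp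
  show "poly ?p (of_nat a) = of_nat (a choose k)" for a
    by (simp add: poly_prod binomial_gbinomial gbinomial_prod_rev atLeast0LessThan divide_inverse)
qed

context vector_space
begin

text \<open>A sequence annihilated by \<open>(1 + E)\<^sup>N\<close>, with \<open>E\<close> the shift, is an alternating sign times
  a polynomial of degree less than \<open>N\<close>; here everything is taken modulo the subspace \<open>Q\<close>.\<close>

lemma alternating_poly:
  assumes Q: "subspace Q"
    and "\<And>a. a + N < J \<Longrightarrow> ((\<lambda>f a. f a + f (Suc a)) ^^ N) u a \<in> Q"
  shows "\<exists>w. \<forall>a<J. u a - (\<Sum>k<N. ((-1) ^ a * of_nat (a choose k)) *s w k) \<in> Q"
  using assms(2)
proof (induction N arbitrary: J u)
  case 0
  then show ?case by simp
next
  case (Suc N)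
  have "((\<lambda>f a. f a + f (Suc a)) ^^ N) (\<lambda>a. u a + u (Suc a)) a \<in> Q" if "a + N < J - 1" for a
    using Suc.prems [of a] that unfolding funpow_Suc_right by simp
  from Suc.IH [OF this] obtain w where
    w: "\<And>a. a < J - 1 \<Longrightarrow>
      u a + u (Suc a) - (\<Sum>k<N. ((-1) ^ a * of_nat (a choose k)) *s w k) \<in> Q"
    by blast
  \<comment> \<open>By Pascal's rule the coefficients of \<open>u\<close> are those of (1 + E) u,
    negated and moved up by one place, with \<open>u 0\<close> as the new constant one.\<close>
  define w' where "w' k = (case k of 0 \<Rightarrow> u 0 | Suc k \<Rightarrow> - w k)" for k
  have "u a - (\<Sum>k<Suc N. ((-1) ^ a * of_nat (a choose k)) *s w' k) \<in> Q" if "a < J" for a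
    using that
  proof (induction a)
    case 0
    have "u 0 - (\<Sum>k<Suc N. ((-1) ^ 0 * of_nat (0 choose k)) *s w' k) = 0"
      unfolding sum.lessThan_Suc_shift by (simp add: w'_def)
    then show ?case using subspace_0 [OF Q] by simp
  next
    case (Suc a)
    let ?S = "\<lambda>a. \<Sum>k<Suc N. ((-1) ^ a * of_nat (a choose k)) *s w' k"
    let ?W = "\<Sum>k<N. ((-1) ^ a * of_nat (a choose k)) *s w k"
    have "?S (Suc a) = - ?S a + ?W"
    proof -
      have "?S (Suc a) = - ((-1) ^ a *s w' 0) -
          (\<Sum>k<N. ((-1) ^ a * of_nat (a choose Suc k)) *s w' (Suc k)) + ?W"
        unfolding sum.lessThan_Suc_shift
        by (simp add: algebra_simps scale_left_distrib sum.distrib sum_negf w'_def)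
      also have "\<dots> = - ?S a + ?W"
        unfolding sum.lessThan_Suc_shift by simp
      finally show ?thesis .
    qed
    then have *: "u (Suc a) - ?S (Suc a) = (u a + u (Suc a) - ?W) - (u a - ?S a)"
      by (simp only: algebra_simps) (simp add: algebra_simps del: sum.lessThan_Suc)
    show ?case
      unfolding * by (rule subspace_diff [OF Q w Suc.IH]) (use Suc.prems in auto)
  qed
  then show ?case by blast
qed

text \<open>The first two hypotheses hold in characteristic zero, which the scalar field of the locale
  cannot be declared to have.\<close>

lemma difference_zero:
  assumes char0: "inj (of_nat :: nat \<Rightarrow> 'a)"
    and polys: "\<And>k. \<exists>p :: 'a poly. Polynomial.degree p \<le> k \<and> (\<forall>a. poly p (of_nat a) = of_nat (a choose k))"
    and Q: "subspace Q"
    and rel: "\<And>a. a + N < J \<Longrightarrow> ((\<lambda>f a. f a + f (Suc a)) ^^ N) u a \<in> Q"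
    and Z: "Z \<subseteq> {..<J}" "N \<le> card Z" "\<And>a. a \<in> Z \<Longrightarrow> u a \<in> Q"
    and a0: "a0 < J"
  shows "u a0 \<in> Q"
proof -
  obtain w where w: "\<And>a. a < J \<Longrightarrow> u a - (\<Sum>k<N. ((-1) ^ a * of_nat (a choose k)) *s w k) \<in> Q"
    using alternating_poly [OF Q rel] by blast
  have finZ: "finite Z" using Z(1) finite_subset by blast
  obtain l :: "'a \<Rightarrow> 'a" where l: "\<And>p. Polynomial.degree p < card Z \<Longrightarrow>
      poly p (of_nat a0) = (\<Sum>b\<in>of_nat ` Z. l b * poly p b)"
    using interpolation_weights [of "of_nat ` Z :: 'a set" "of_nat a0"] finZ
      card_image [OF inj_on_subset [OF char0], of Z] by auto
  \<comment> \<open>Without the sign, \<open>u\<close> is modulo \<open>Q\<close> a polynomial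
    \<open>W\<close> of degree below \<open>N\<close> with vector coefficients. The scalar weights
    \<open>l\<close>, applied to each binomial coefficient, carry membership in \<open>Q\<close>
    from \<open>Z\<close> to \<open>a0\<close>.\<close>
  define W where "W a = (\<Sum>k<N. of_nat (a choose k) *s w k)" for a
  have uW: "u a - (-1) ^ a *s W a \<in> Q" if "a < J" for a
    using w [OF that] by (simp add: W_def scale_sum_right)
  have W_in: "W a \<in> Q" if "a \<in> Z" for a
  proof -
    have "a < J" using that Z by auto
    from subspace_diff [OF Q Z(3) [OF that] uW [OF this]] have "(-1) ^ a *s W a \<in> Q" by simp
    from subspace_scale [OF Q this, of "(-1) ^ a"] show ?thesis
      by (simp add: power_mult_distrib [symmetric])
  qed
  have "of_nat (a0 choose k) = (\<Sum>b\<in>Z. l (of_nat b) * of_nat (b choose k))" if "k < N" for k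
  proof -
    obtain p :: "'a poly" where p: "Polynomial.degree p \<le> k" "\<And>a. poly p (of_nat a) = of_nat (a choose k)"
      using polys by blast
    have "of_nat (a0 choose k) = poly p (of_nat a0)" by (simp add: p)
    also have "\<dots> = (\<Sum>b\<in>of_nat ` Z. l b * poly p b)"
      by (rule l) (use p that Z in linarith)
    also have "\<dots> = (\<Sum>b\<in>Z. l (of_nat b) * of_nat (b choose k))"
      using char0 by (subst sum.reindex) (auto simp: p intro: inj_on_subset)
    finally show ?thesis .
  qed
  then have "W a0 = (\<Sum>k<N. \<Sum>b\<in>Z. l (of_nat b) *s (of_nat (b choose k) *s w k))"
    by (simp add: W_def scale_sum_left)
  also have "\<dots> = (\<Sum>b\<in>Z. l (of_nat b) *s W b)"
    unfolding W_def by (subst sum.swap) (simp add: scale_sum_right)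
  finally have "W a0 \<in> Q"
    using W_in by (auto intro!: subspace_sum [OF Q] subspace_scale [OF Q])
  from subspace_add [OF Q uW [OF a0] subspace_scale [OF Q this, of "(-1) ^ a0"]]
  show ?thesis by simp
qed

text \<open>By Gaussian elimination over the polynomial ring: \<open>P\<close> is invertible at all but finitely
  many parameters, as it is at \<open>0\<close>.\<close>

lemma generic_elimination:
  fixes P :: "'i \<Rightarrow> 'i \<Rightarrow> 'a poly"
  assumes "finite B"
    and "\<And>b b'. b \<in> B \<Longrightarrow> b' \<in> B \<Longrightarrow> poly (P b b') 0 = (if b = b' then 1 else 0)"
  shows "\<exists>F. finite F \<and> (\<forall>t Q e. t \<notin> F \<longrightarrow> subspace Q \<longrightarrow>
    (\<forall>b\<in>B. (\<Sum>b'\<in>B. poly (P b b') t *s e b') \<in> Q) \<longrightarrow> (\<forall>b\<in>B. e b \<in> Q))"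
  using assms
proof (induction B arbitrary: P)
  case (insert c B)
  \<comment> \<open>Fraction-free elimination with pivot \<open>P c c\<close>. At parameter 0 the
    reduced matrix is again the identity; the roots of the pivot join the exceptions.\<close>
  define P' where "P' b b' = P c c * P b b' - P b c * P c b'" for b b'
  have "poly (P' b b') 0 = (if b = b' then 1 else 0)" if "b \<in> B" "b' \<in> B" for b b'
    using that insert.hyps insert.prems [of c c] insert.prems [of b b'] insert.prems [of b c]
    by (auto simp: P'_def)
  from insert.IH [OF this] obtain F where F: "finite F"
    "\<And>t Q e. t \<notin> F \<Longrightarrow> subspace Q \<Longrightarrow>
      \<forall>b\<in>B. (\<Sum>b'\<in>B. poly (P' b b') t *s e b') \<in> Q \<Longrightarrow> \<forall>b\<in>B. e b \<in> Q"
    by blast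
  have "P c c \<noteq> 0" using insert.prems [of c c] by auto
  then have fin: "finite (F \<union> {t. poly (P c c) t = 0})"
    using F(1) poly_roots_finite by blast
  have "\<forall>b\<in>insert c B. e b \<in> Q"
    if t: "t \<notin> F \<union> {t. poly (P c c) t = 0}" and Q: "subspace Q"
      and rows: "\<forall>b\<in>insert c B. (\<Sum>b'\<in>insert c B. poly (P b b') t *s e b') \<in> Q" for t Q e
  proof -
    let ?R = "\<lambda>b. \<Sum>b'\<in>B. poly (P b b') t *s e b'"
    have row: "poly (P b c) t *s e c + ?R b \<in> Q" if "b \<in> insert c B" for b
      using rows that insert.hyps by auto
    have "(\<Sum>b'\<in>B. poly (P' b b') t *s e b') \<in> Q" if "b \<in> B" for b
    proof -
      have "(\<Sum>b'\<in>B. poly (P' b b') t *s e b') =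
          poly (P c c) t *s ?R b - poly (P b c) t *s ?R c"
        by (simp add: P'_def scale_left_diff_distrib sum_subtractf scale_sum_right)
      also have "\<dots> = poly (P c c) t *s (poly (P b c) t *s e c + ?R b) -
          poly (P b c) t *s (poly (P c c) t *s e c + ?R c)"
        by (simp add: scale_right_distrib mult.commute)
      finally show ?thesis
        using row [of b] row [of c] that by (auto intro: subspace_diff [OF Q] subspace_scale [OF Q])
    qed
    with F(2) [of t Q e] t Q have B: "\<forall>b\<in>B. e b \<in> Q" by auto
    then have "?R c \<in> Q" by (auto intro: subspace_sum [OF Q] subspace_scale [OF Q])
    from subspace_diff [OF Q row [of c] this] have "poly (P c c) t *s e c \<in> Q" by simp
    from subspace_scale [OF Q this, of "inverse (poly (P c c) t)"] t have "e c \<in> Q" by simp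
    with B show ?thesis by simp
  qed
  with fin show ?case by blast
qed auto

end

section \<open>Lifting surjectivity from the associated graded ring\<close>

text \<open>The forms of degree \<open>j\<close> in the \<open>n\<close> variables and one further variable \<open>w\<close>, with respect to
  which these are univariate polynomials.\<close>

definition bihom :: "nat \<Rightarrow> nat \<Rightarrow> 'k::comm_ring_1 mpoly poly set" where
  "bihom n j = {p. \<forall>k. coeff p k \<in> (if k \<le> j then homog n (j - k) else {0})}"

lemma bihomI:
  "(\<And>k. k \<le> j \<Longrightarrow> coeff p k \<in> homog n (j - k)) \<Longrightarrow> (\<And>k. j < k \<Longrightarrow> coeff p k = 0) \<Longrightarrow> p \<in> bihom n j"
  by (auto simp: bihom_def)

lemma bihom_coeff: "p \<in> bihom n j \<Longrightarrow> k \<le> j \<Longrightarrow> coeff p k \<in> homog n (j - k)"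
  unfolding bihom_def by (metis (mono_tags, lifting) mem_Collect_eq)

lemma bihom_coeff_0: "p \<in> bihom n j \<Longrightarrow> j < k \<Longrightarrow> coeff p k = 0"
  unfolding bihom_def by (metis (mono_tags, lifting) mem_Collect_eq not_le singletonD)

lemma bihom_0 [simp]: "0 \<in> bihom n j"
  by (rule bihomI) auto

lemma bihom_add: "p \<in> bihom n j \<Longrightarrow> q \<in> bihom n j \<Longrightarrow> p + q \<in> bihom n j"
  by (intro bihomI) (auto simp: bihom_coeff_0 intro: homog_add bihom_coeff)

lemma bihom_diff: "p \<in> bihom n j \<Longrightarrow> q \<in> bihom n j \<Longrightarrow> p - q \<in> bihom n j"
  by (intro bihomI) (auto simp: bihom_coeff_0 intro: homog_diff bihom_coeff)

lemma bihom_smult: "p \<in> bihom n j \<Longrightarrow> smult (Const c) p \<in> bihom n j"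
  by (intro bihomI) (auto simp: bihom_coeff_0 intro: homog_Const_mult bihom_coeff)

lemma bihom_sum: "(\<And>x. x \<in> X \<Longrightarrow> f x \<in> bihom n j) \<Longrightarrow> (\<Sum>x\<in>X. f x) \<in> bihom n j"
  by (induction X rule: infinite_finite_induct) (auto intro: bihom_add)

lemma bihom_monom: "f \<in> homog n a \<Longrightarrow> a + k = j \<Longrightarrow> monom f k \<in> bihom n j"
  by (rule bihomI) auto

text \<open>The polynomial \<open>[:y, 1:]\<close> is the form y + w of degree one.\<close>

lemma bihom_step:
  assumes "y \<in> homog n 1" "p \<in> bihom n j"
  shows "[:y, 1:] * p \<in> bihom n (Suc j)"
proof (rule bihomI)
  fix k
  have c: "coeff ([:y, 1:] * p) k = y * coeff p k + (case k of 0 \<Rightarrow> 0 | Suc k \<Rightarrow> coeff p k)"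
    by (simp add: coeff_pCons)
  show "coeff ([:y, 1:] * p) k \<in> homog n (Suc j - k)" if "k \<le> Suc j"
  proof -
    have "y * coeff p k \<in> homog n (Suc j - k)"
    proof (cases "k \<le> j")
      case True
      from homog_mult' [OF assms(1) bihom_coeff [OF assms(2) True]] True show ?thesis
        by (simp add: Suc_diff_le)
    next
      case False
      then show ?thesis using bihom_coeff_0 [OF assms(2), of k] by simp
    qed
    moreover have "(case k of 0 \<Rightarrow> 0 | Suc k \<Rightarrow> coeff p k) \<in> homog n (Suc j - k)"
      using that bihom_coeff [OF assms(2)] by (cases k) auto
    ultimately show ?thesis unfolding c by (rule homog_add)
  qed
  show "coeff ([:y, 1:] * p) k = 0" if "Suc j < k"
    unfolding c using that bihom_coeff_0 [OF assms(2)] by (cases k) auto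
qed

lemma bihom_step_power:
  assumes "y \<in> homog n 1" "p \<in> bihom n j"
  shows "[:y, 1:] ^ N * p \<in> bihom n (N + j)"
proof (induction N)
  case (Suc N)
  from bihom_step [OF assms(1) this] show ?case by (simp only: power_Suc mult.assoc add_Suc)
qed (use assms in simp)

lemma bihom_degree: "p \<in> bihom n j \<Longrightarrow> Polynomial.degree p \<le> j"
  by (rule degree_le) (auto simp: bihom_coeff_0)

lemma bihom_sum_monom: "p \<in> bihom n j \<Longrightarrow> p = (\<Sum>k\<le>j. monom (coeff p k) k)"
  by (simp add: poly_as_sum_of_monoms' bihom_degree)

lemma bihom_poly:
  assumes "p \<in> bihom n j"
  shows "poly p x = (\<Sum>k\<le>j. coeff p k * x ^ k)"
  by (subst bihom_sum_monom [OF assms]) (simp add: poly_sum poly_monom)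

text \<open>Monomials times powers of w span. Finiteness reduces the later openness argument to one
  matrix.\<close>

lemma bihom_finite_span:
  "\<exists>B :: 'k::field mpoly poly set. finite B \<and> B \<subseteq> bihom n j \<and>
     (\<forall>p \<in> bihom n j. \<exists>c. p = (\<Sum>b\<in>B. smult (Const (c b)) b))"
proof -
  define b where "b = (\<lambda>(k, m). monom (Poly_Mapping.single (m :: nat \<Rightarrow>\<^sub>0 nat) (1::'k)) k)"
  let ?I = "SIGMA k:{..j}. mons n (j - k)"
  have inj: "inj_on b ?I"
  proof (rule inj_onI, clarify)
    fix k m k' m' assume "b (k, m) = b (k', m')"
    then have *: "coeff (b (k, m)) i = coeff (b (k', m')) i" for i by simp
    from * [of k] have "k = k'"
      by (auto simp: b_def split: if_splits)
         (metis keys_single keys_zero insert_not_empty zero_neq_one)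
    moreover from * [of k] this have "Poly_Mapping.single m (1::'k) = Poly_Mapping.single m' 1"
      by (simp add: b_def)
    then have "m = m'"
      by (metis lookup_single_eq lookup_single_not_eq zero_neq_one)
    ultimately show "k = k' \<and> m = m'" by simp
  qed
  show ?thesis
  proof (intro exI conjI ballI)
    show "finite (b ` ?I)" by (auto simp: finite_mons)
    show "b ` ?I \<subseteq> bihom n j"
      by (auto simp: b_def intro!: bihom_monom mons_homog)
    fix p :: "'k mpoly poly" assume p: "p \<in> bihom n j"
    define c where "c x = (case the_inv_into ?I b x of (k, m) \<Rightarrow> Poly_Mapping.lookup (coeff p k) m)" for x
    have "p = (\<Sum>k\<le>j. monom (\<Sum>m\<in>mons n (j - k).
        Const (Poly_Mapping.lookup (coeff p k) m) * Poly_Mapping.single m 1) k)"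
      using homog_sum_mons [OF bihom_coeff [OF p]]
      by (subst bihom_sum_monom [OF p]) (auto intro!: sum.cong)
    also have "\<dots> = (\<Sum>k\<le>j. \<Sum>m\<in>mons n (j - k).
        smult (Const (Poly_Mapping.lookup (coeff p k) m)) (b (k, m)))"
      by (simp add: b_def smult_monom monom_sum)
    also have "\<dots> = (\<Sum>x\<in>?I. smult (Const (c (b x))) (b x))"
      by (subst sum.Sigma) (auto simp: finite_mons c_def the_inv_into_f_f [OF inj] intro!: sum.cong)
    also have "\<dots> = (\<Sum>x\<in>b ` ?I. smult (Const (c x)) x)"
      by (subst sum.reindex [OF inj]) simp
    finally show "p = (\<Sum>x\<in>b ` ?I. smult (Const (c x)) x)" .
  qed
qed

text \<open>The surjectivity half of the strong Lefschetz property; it is enough to consider pairs of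
  degrees symmetric about \<open>c/2\<close>.\<close>

definition Surj :: "nat \<Rightarrow> 'k::comm_ring_1 mpoly set \<Rightarrow> 'k mpoly \<Rightarrow> nat \<Rightarrow> bool" where
  "Surj n I y c \<longleftrightarrow> (\<forall>j>c. homog n j \<subseteq> I) \<and>
     (\<forall>i. 2 * i \<le> c \<longrightarrow> (\<forall>f\<in>homog n (c - i). \<exists>h\<in>homog n i. f - y ^ (c - 2 * i) * h \<in> I))"

text \<open>One step is y^a q w^(k+1) + y^(a+1) q w^k = (y + w) y^a q w^k. So 1 + shift acts on
  these sequences as multiplication by y + w.\<close>

lemma shift_power:
  fixes y q :: "'a::comm_ring_1"
  assumes "a + N \<le> J"
  shows "((\<lambda>f a. f a + f (Suc a)) ^^ N) (\<lambda>a. monom (y ^ a * q) (J - a)) a =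
    [:y, 1:] ^ N * monom (y ^ a * q) (J - N - a)"
  using assms
proof (induction N arbitrary: a)
  case (Suc N)
  define k where "k = J - Suc N - a"
  have k: "J - N - a = Suc k" "J - N - Suc a = k" using Suc.prems by (auto simp: k_def)
  let ?u = "((\<lambda>f a. f a + f (Suc a)) ^^ N) (\<lambda>a. monom (y ^ a * q) (J - a))"
  have "monom (y ^ a * q) (Suc k) + monom (y ^ Suc a * q) k = [:y, 1:] * monom (y ^ a * q) k"
    by (simp add: monom_Suc smult_monom mult.assoc)
  moreover have "?u a = [:y, 1:] ^ N * monom (y ^ a * q) (Suc k)"
    using Suc.IH [of a] Suc.prems unfolding k by simp
  moreover have "?u (Suc a) = [:y, 1:] ^ N * monom (y ^ Suc a * q) k"
    using Suc.IH [of "Suc a"] Suc.prems unfolding k by simp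
  ultimately have "?u a + ?u (Suc a) = [:y, 1:] ^ N * ([:y, 1:] * monom (y ^ a * q) k)"
    by (simp only: distrib_left [symmetric])
  then show ?case
    unfolding k_def [symmetric] funpow.simps o_apply by (simp only: power_Suc2 mult.assoc)
qed simp

text \<open>This replaces the strong Lefschetz property of \<open>U \<otimes> K[w]/(w\<^sup>D)\<close>, with \<open>U\<close> the image of
  multiplication by \<open>x\<close>: the numerical hypothesis relates the socle degrees, and also covers
  the case in which no image under \<open>(y + w)\<^sup>N\<close> has degree \<open>j\<close>.\<close>

lemma string_span:
  fixes Q :: "'k::field_char_0 mpoly poly set"
  assumes S: "Surj n (gen_ideal n g) y e"
    and y: "y \<in> homog n 1" and x: "x \<in> homog n \<delta>" and Q: "mpp.subspace Q"
    and N: "N + e + D + 2 * \<delta> = 2 * j + 1"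
    and img: "\<And>h. N \<le> j \<Longrightarrow> h \<in> bihom n (j - N) \<Longrightarrow> [:y, 1:] ^ N * h \<in> Q"
    and idl: "\<And>f a k. f \<in> gen_ideal n g \<Longrightarrow> f \<in> homog n a \<Longrightarrow> k + \<delta> + a = j \<Longrightarrow> monom (x * f) k \<in> Q"
    and top: "\<And>f a k. D \<le> k \<Longrightarrow> f \<in> homog n a \<Longrightarrow> k + \<delta> + a = j \<Longrightarrow> monom (x * f) k \<in> Q"
    and f: "f \<in> homog n a" "k + \<delta> + a = j"
  shows "monom (x * f) k \<in> Q"
proof -
  have inj: "inj (of_nat :: nat \<Rightarrow> 'k)" by (simp add: inj_of_nat)
  \<comment> \<open>Here \<open>p\<close> is primitive: its string p, y p, y^2 p, ... vanishes
    modulo the ideal from the term \<open>m\<close> on. The sequence \<open>u\<close> lists the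
    products of x, a string term and a power of w in total degree \<open>j\<close>; \<open>Z\<close>
    holds the positions settled by \<open>idl\<close> or \<open>top\<close>.\<close>
  have prim: "monom (x * (y ^ l * p)) k \<in> Q"
    if p: "p \<in> homog n b" "2 * b \<le> e" "y ^ (e - 2 * b + 1) * p \<in> gen_ideal n g"
      and kl: "k + l + \<delta> + b = j" for p b k l
  proof -
    define m where "m = e - 2 * b + 1"
    define J where "J = k + l"
    define Z where "Z = {a. a < J + 1 \<and> (m \<le> a \<or> D \<le> J - a)}"
    define u where "u a = monom (y ^ a * (x * p)) (J - a)" for a
    have arith: "N + m + D = 2 * J + 2" using N p(2) kl by (simp add: m_def J_def)
    have hom: "y ^ a * p \<in> homog n (a + b)" for a
      using homog_mult [OF homog_power1 [OF y] p(1)] .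
    have Zu: "u a \<in> Q" if "a \<in> Z" for a
    proof -
      have deg: "J - a + \<delta> + (a + b) = j" using that kl by (auto simp: Z_def J_def)
      have eq: "u a = monom (x * (y ^ a * p)) (J - a)"
        by (simp add: u_def mult.left_commute)
      show ?thesis
      proof (cases "m \<le> a")
        case True
        then have "y ^ a * p = y ^ (a - m) * (y ^ m * p)"
          by (simp add: mult.assoc [symmetric] power_add [symmetric])
        moreover have "y ^ m * p \<in> gen_ideal n g" using p(3) by (simp only: m_def)
        ultimately have "y ^ a * p \<in> gen_ideal n g"
          using y by (simp only: gen_ideal_mult homog_polyring polyring_power)
        from idl [OF this hom deg] show ?thesis by (simp add: eq)
      next
        case False
        with that have "D \<le> J - a" by (auto simp: Z_def)
        from top [OF this hom deg] show ?thesis by (simp add: eq)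
      qed
    qed
    have "u l \<in> Q"
    proof (cases "l \<in> Z")
      case False
      have finZ: "finite Z" by (rule finite_subset [of _ "{..<J + 1}"]) (auto simp: Z_def)
      have "l < m" "J < l + D" using False by (auto simp: Z_def J_def)
      \<comment> \<open>Outside \<open>Z\<close> both a < m and J - a < D hold. Counting these
        positions, \<open>arith\<close> leaves at least \<open>N\<close> zeros, also when one of the
        differences is truncated.\<close>
      have "{..<J + 1} - Z \<subseteq> {J + 1 - D..<min m (J + 1)}" by (auto simp: Z_def)
      from card_mono [OF _ this]
      have "card ({..<J + 1} - Z) \<le> min m (J + 1) - (J + 1 - D)" by simp
      moreover have "card ({..<J + 1} - Z) = J + 1 - card Z"
        using finZ by (subst card_Diff_subset) (auto simp: Z_def)
      ultimately have "J + 1 - card Z \<le> min m (J + 1) - (J + 1 - D)" by simp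
      then have "N \<le> card Z"
        using arith \<open>l < m\<close> \<open>J < l + D\<close> by (auto simp: min_def J_def split: if_splits)
      moreover have "((\<lambda>f a. f a + f (Suc a)) ^^ N) u a \<in> Q" if "a + N < J + 1" for a
      proof -
        have "y ^ a * (x * p) \<in> homog n (a + (\<delta> + b))"
          by (intro homog_mult homog_power1 x y p)
        then have "monom (y ^ a * (x * p)) (J - N - a) \<in> bihom n (j - N)"
          by (rule bihom_monom) (use that kl in \<open>simp add: J_def\<close>)
        moreover have "N \<le> j" using that kl by (simp add: J_def)
        ultimately show ?thesis
          using img shift_power [of a N J y "x * p"] that by (simp add: u_def [abs_def])
      qed
      ultimately show ?thesis
        using mpp.difference_zero [OF inj binomial_as_poly Q, of N "J + 1" u Z l] Zu
        by (auto simp: Z_def J_def)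
    qed (rule Zu)
    then show ?thesis by (simp add: u_def J_def mult.left_commute)
  qed
  \<comment> \<open>Primitive decomposition by induction on the degree: modulo the ideal, every form
    is a sum of powers of \<open>y\<close> times primitive forms. The extra factor
    \<open>y ^ l\<close> absorbs the powers that arise.\<close>
  have "\<forall>l k. k + l + \<delta> + a = j \<longrightarrow> monom (x * (y ^ l * f)) k \<in> Q"
    using f(1)
  proof (induction a arbitrary: f rule: less_induct)
    case (less a)
    have ideal: "monom (x * (y ^ l * r)) k \<in> Q"
      if "r \<in> gen_ideal n g" "r \<in> homog n a" "k + l + \<delta> + a = j" for l k r
    proof (rule idl)
      show "y ^ l * r \<in> gen_ideal n g"
        using that y by (simp add: gen_ideal_mult homog_polyring polyring_power)
      show "y ^ l * r \<in> homog n (l + a)"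
        by (intro homog_mult homog_power1 y that)
    qed (use that in simp)
    consider "e < a" | "a \<le> e" "e < 2 * a" | "a = 0" | a' where "a = Suc a'" "2 * a \<le> e"
    proof -
      have "e < a \<or> (a \<le> e \<and> e < 2 * a) \<or> a = 0 \<or> (\<exists>a'. a = Suc a' \<and> 2 * a \<le> e)"
        by (cases a) auto
      then show thesis using that by blast
    qed
    then show ?case
    proof cases
      case 1
      with S less.prems have "f \<in> gen_ideal n g" by (auto simp: Surj_def)
      show ?thesis
        by (intro allI impI) (rule ideal [OF \<open>f \<in> gen_ideal n g\<close> less.prems])
    next
      case 2
      \<comment> \<open>Above the middle degree, surjectivity makes \<open>f\<close> a power of
        \<open>y\<close> times a form of smaller degree.\<close>
      define i where "i = e - a"
      have i: "2 * i \<le> e" "a = e - i" "i < a" using 2 by (auto simp: i_def)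
      with S less.prems obtain h where h: "h \<in> homog n i" "f - y ^ (e - 2 * i) * h \<in> gen_ideal n g"
        unfolding Surj_def by blast
      show ?thesis
      proof (intro allI impI)
        fix l k assume kl: "k + l + \<delta> + a = j"
        have 1: "monom (x * (y ^ (l + (e - 2 * i)) * h)) k \<in> Q"
          using less.IH [OF i(3) h(1)] kl i by auto
        have "f - y ^ (e - 2 * i) * h \<in> homog n a"
          using i by (intro homog_diff less.prems homog_power_mult [OF y h(1)]) auto
        from mpp.subspace_add [OF Q 1 ideal [OF h(2) this kl]]
        moreover have "x * (y ^ (l + (e - 2 * i)) * h) + x * (y ^ l * (f - y ^ (e - 2 * i) * h)) =
            x * (y ^ l * f)"
          unfolding power_add by algebra
        ultimately show "monom (x * (y ^ l * f)) k \<in> Q"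
          unfolding add_monom by simp
      qed
    next
      case 3
      \<comment> \<open>A constant is primitive, since degree e + 1 vanishes in the
        quotient.\<close>
      have "y ^ (e - 2 * a + 1) * f \<in> homog n (e + 1)"
        using 3 by (intro homog_power_mult [OF y less.prems]) auto
      with S have "y ^ (e - 2 * a + 1) * f \<in> gen_ideal n g" by (auto simp: Surj_def)
      with 3 show ?thesis
        by (intro allI impI) (rule prim [OF less.prems], auto)
    next
      case 4
      \<comment> \<open>Up to the middle degree, surjectivity is applied after multiplying by a
        power of \<open>y\<close>; it yields \<open>h\<close> of degree a - 1 such that
        \<open>f - y * h\<close> is primitive.\<close>
      have "y ^ (e - 2 * a + 1) * f \<in> homog n (e - a')"
        using 4 by (intro homog_power_mult [OF y less.prems]) auto
      moreover have "2 * a' \<le> e" using 4 by simp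
      ultimately obtain h where h: "h \<in> homog n a'"
          "y ^ (e - 2 * a + 1) * f - y ^ (e - 2 * a') * h \<in> gen_ideal n g"
        using S unfolding Surj_def by blast
      have "e - 2 * a' = (e - 2 * a + 1) + 1" using 4 by simp
      with h(2) have 1: "y ^ (e - 2 * a + 1) * (f - y * h) \<in> gen_ideal n g"
        by (simp add: algebra_simps)
      have p: "f - y * h \<in> homog n a"
        using 4 by (intro homog_diff less.prems homog_mult' [OF y h(1)]) auto
      show ?thesis
      proof (intro allI impI)
        fix l k assume kl: "k + l + \<delta> + a = j"
        have "monom (x * (y ^ Suc l * h)) k \<in> Q"
          by (rule less.IH [rule_format, OF _ h(1)]) (use kl 4 in auto)
        from mpp.subspace_add [OF Q this prim [OF p _ 1 kl]] 4
        have "monom (x * (y ^ Suc l * h) + x * (y ^ l * (f - y * h))) k \<in> Q"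
          unfolding add_monom by simp
        moreover have "x * (y ^ Suc l * h) + x * (y ^ l * (f - y * h)) = x * (y ^ l * f)"
          unfolding power_Suc by algebra
        ultimately show "monom (x * (y ^ l * f)) k \<in> Q" by simp
      qed
    qed
  qed
  from this [rule_format, of k 0] f(2) show ?thesis by simp
qed

text \<open>Substituting t z for w turns a decomposition in the associated graded ring into one
  modulo the ideal, with an error of order 1/t. On a finite spanning set the errors form a matrix M,
  and 1 - u M with u = 1/t is invertible for almost all u. The alternative \<open>h = 0\<close> is
  the case of a negative source degree.\<close>

lemma generic_spanning:
  fixes y z :: "'k::field mpoly"
  assumes y: "y \<in> homog n 1" and z: "z \<in> homog n 1"
    and hom: "\<And>i. i < n \<Longrightarrow> \<exists>b. g i \<in> homog n b"
    and cover: "\<And>p. p \<in> bihom n j \<Longrightarrow> \<exists>h s. (if N \<le> j then h \<in> bihom n (j - N) else h = 0) \<and>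
      p = [:y, 1:] ^ N * h + s \<and>
      (\<forall>k. \<exists>r\<in>polyring n. z ^ k * coeff s k - z ^ Suc k * r \<in> gen_ideal n g)"
  shows "\<exists>F. finite F \<and> (\<forall>u. u \<notin> F \<longrightarrow> (\<forall>f\<in>homog n j. \<exists>h.
    (if N \<le> j then h \<in> homog n (j - N) else h = 0) \<and>
    f - (y + Const (inverse u) * z) ^ N * h \<in> gen_ideal n g))"
proof -
  define W where "W t = {f. \<exists>h. (if N \<le> j then h \<in> homog n (j - N) else h = 0) \<and>
    f - (y + Const t * z) ^ N * h \<in> gen_ideal n g}" for t
  have W: "mp.subspace (W t)" for t
  proof (rule mp.subspaceI)
    show "0 \<in> W t" unfolding W_def by (rule CollectI, rule exI [of _ 0]) simp
    show "p + q \<in> W t" if "p \<in> W t" "q \<in> W t" for p q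
    proof -
      from that obtain h h' where h: "if N \<le> j then h \<in> homog n (j - N) else h = 0"
        "p - (y + Const t * z) ^ N * h \<in> gen_ideal n g"
        "if N \<le> j then h' \<in> homog n (j - N) else h' = 0"
        "q - (y + Const t * z) ^ N * h' \<in> gen_ideal n g" by (auto simp: W_def)
      have "p + q - (y + Const t * z) ^ N * (h + h') \<in> gen_ideal n g"
        using gen_ideal_add [OF h(2,4)] by (simp add: algebra_simps)
      with h(1,3) show ?thesis unfolding W_def
        by (intro CollectI exI [of _ "h + h'"]) (auto intro: homog_add split: if_splits)
    qed
    show "Const c * p \<in> W t" if "p \<in> W t" for c p
    proof -
      from that obtain h where h: "if N \<le> j then h \<in> homog n (j - N) else h = 0"
        "p - (y + Const t * z) ^ N * h \<in> gen_ideal n g" by (auto simp: W_def)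
      have "Const c * p - (y + Const t * z) ^ N * (Const c * h) \<in> gen_ideal n g"
        using gen_ideal_Const [OF h(2), of c] by (simp add: algebra_simps)
      with h(1) show ?thesis unfolding W_def
        by (intro CollectI exI [of _ "Const c * h"]) (auto intro: homog_Const_mult split: if_splits)
    qed
  qed
  have gW: "f \<in> W t" if "f \<in> gen_ideal n g" for f t
    using that unfolding W_def by (intro CollectI exI [of _ 0]) simp
  have eval_homog: "poly h (Const t * z) \<in> homog n i" if "h \<in> bihom n i" for h t i
  proof -
    have "poly h (Const t * z) = (\<Sum>k\<le>i. coeff h k * (Const t * z) ^ k)"
      by (rule bihom_poly [OF that])
    also have "\<dots> \<in> homog n i"
      by (intro homog_sum homog_mult' [OF bihom_coeff [OF that] homog_power1]
           homog_Const_mult z) auto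
    finally show ?thesis .
  qed
  have step: "\<exists>r. r \<in> bihom n j \<and> (\<forall>t. t \<noteq> 0 \<longrightarrow>
      poly p (Const t * z) - Const (inverse t) * poly r (Const t * z) \<in> W t)"
    if p: "p \<in> bihom n j" for p
  proof -
    obtain h s where h: "if N \<le> j then h \<in> bihom n (j - N) else h = 0"
      and ps: "p = [:y, 1:] ^ N * h + s"
      and "\<forall>k. \<exists>r\<in>polyring n. z ^ k * coeff s k - z ^ Suc k * r \<in> gen_ideal n g"
      using cover [OF p] by blast
    then obtain r where r: "\<And>k. r k \<in> polyring n"
        "\<And>k. z ^ k * coeff s k - z ^ Suc k * r k \<in> gen_ideal n g" by metis
    have "[:y, 1:] ^ N * h \<in> bihom n j"
    proof (cases "N \<le> j")
      case True
      then show ?thesis using h bihom_step_power [OF y, of h "j - N" N] by simp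
    qed (use h in simp)
    then have s: "s \<in> bihom n j" using bihom_diff [OF p] ps by (metis add_diff_cancel_left')
    \<comment> \<open>Only the part of degree \<open>j\<close> of the relation matters; taking it
      makes the error term bihomogeneous.\<close>
    define r' where "r' k = hcomp (j - Suc k) (r k)" for k
    have r': "r' k \<in> homog n (j - Suc k)" for k
      unfolding r'_def by (rule hcomp_in_homog [OF r(1)])
    have low: "z ^ k * coeff s k - z ^ Suc k * r' k \<in> gen_ideal n g" if "k < j" for k
    proof -
      have 1: "hcomp j (z ^ k * coeff s k) = z ^ k * coeff s k"
        using that by (simp add: hcomp_homog [OF homog_power_mult [OF z bihom_coeff [OF s]]])
      have 2: "hcomp j (z ^ Suc k * r k) = z ^ Suc k * r' k"
        using that hcomp_mult_homog [OF r(1) homog_power1 [OF z], of j k "Suc k"]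
        by (simp add: r'_def mult.commute)
      from gen_ideal_hcomp [OF hom r(2), of j k] show ?thesis
        unfolding hcomp_diff 1 2 .
    qed
    \<comment> \<open>For k = j the multiple of z^(j+1) has no part of degree \<open>j\<close>, so
      no error remains.\<close>
    have high: "z ^ j * coeff s j \<in> gen_ideal n g"
    proof -
      have 1: "hcomp j (z ^ j * coeff s j) = z ^ j * coeff s j"
        by (simp add: hcomp_homog [OF homog_power_mult [OF z bihom_coeff [OF s]]])
      have 2: "hcomp j (z ^ Suc j * r j) = 0"
        using hcomp_mult_homog [OF r(1) homog_power1 [OF z], of j j "Suc j"]
        by (simp add: mult.commute)
      from gen_ideal_hcomp [OF hom r(2), of j j] show ?thesis
        unfolding hcomp_diff 1 2 by simp
    qed
    \<comment> \<open>Since t^k z^(k+1) r = (1/t) (t z)^(k+1) r, the error is 1/t times the value of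
      \<open>R\<close> at t z; hence the exponent \<open>Suc k\<close>.\<close>
    define R where "R = (\<Sum>k<j. monom (r' k) (Suc k))"
    have "R \<in> bihom n j"
      unfolding R_def by (intro bihom_sum bihom_monom [OF r']) auto
    moreover have "poly p (Const t * z) - Const (inverse t) * poly R (Const t * z) \<in> W t"
      if t: "t \<noteq> 0" for t
    proof -
      have ps': "poly p (Const t * z) =
          (y + Const t * z) ^ N * poly h (Const t * z) + poly s (Const t * z)"
        by (simp add: ps)
      have tt: "Const (inverse t) * Const t = 1"
        using t by (simp add: Const_mult [symmetric])
      have "poly s (Const t * z) = (\<Sum>k\<le>j. coeff s k * (Const t * z) ^ k)"
        by (rule bihom_poly [OF s])
      also have "\<dots> = (\<Sum>k<j. coeff s k * (Const t * z) ^ k) + coeff s j * (Const t * z) ^ j"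
        by (simp add: lessThan_Suc_atMost [symmetric])
      finally have se: "poly s (Const t * z) =
          (\<Sum>k<j. coeff s k * (Const t * z) ^ k) + coeff s j * (Const t * z) ^ j" .
      have "Const (inverse t) * poly R (Const t * z) =
          (\<Sum>k<j. (Const (inverse t) * Const t) * (r' k * (z * (Const t * z) ^ k)))"
        unfolding R_def poly_sum poly_monom sum_distrib_left
        by (intro sum.cong refl) (simp only: power_Suc mult_ac)
      also have "\<dots> = (\<Sum>k<j. r' k * (z * (Const t * z) ^ k))"
        by (simp add: tt)
      finally have Re: "Const (inverse t) * poly R (Const t * z) =
          (\<Sum>k<j. r' k * (z * (Const t * z) ^ k))" .
      have "poly s (Const t * z) - Const (inverse t) * poly R (Const t * z) =
          (\<Sum>k<j. coeff s k * (Const t * z) ^ k - r' k * (z * (Const t * z) ^ k)) +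
          coeff s j * (Const t * z) ^ j"
        unfolding se Re sum_subtractf by simp
      also have "\<dots> =
          (\<Sum>k<j. Const (t ^ k) * (z ^ k * coeff s k - z ^ Suc k * r' k)) +
          Const (t ^ j) * (z ^ j * coeff s j)"
        by (intro arg_cong2 [where f = "(+)"] sum.cong refl)
           (simp_all only: Const_power power_mult_distrib power_Suc right_diff_distrib mult_ac)
      also have "\<dots> \<in> gen_ideal n g"
        by (intro gen_ideal_add gen_ideal_sum gen_ideal_Const low high) simp
      finally have "poly s (Const t * z) - Const (inverse t) * poly R (Const t * z) \<in> gen_ideal n g" .
      moreover have "if N \<le> j then poly h (Const t * z) \<in> homog n (j - N) else poly h (Const t * z) = 0"
        using h eval_homog by (auto split: if_splits)
      ultimately show ?thesis
        unfolding W_def ps' by (intro CollectI exI [of _ "poly h (Const t * z)"]) (simp add: algebra_simps)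
    qed
    ultimately show ?thesis by blast
  qed
  obtain B :: "'k mpoly poly set" where "finite B \<and> B \<subseteq> bihom n j \<and>
      (\<forall>p\<in>bihom n j. \<exists>c. p = (\<Sum>b\<in>B. smult (Const (c b)) b))"
    using bihom_finite_span [of n j] by (rule exE)
  then have B: "finite B" "B \<subseteq> bihom n j"
      "\<And>p. p \<in> bihom n j \<Longrightarrow> \<exists>c. p = (\<Sum>b\<in>B. smult (Const (c b)) b)"
    by simp_all
  obtain r where r: "\<And>b. b \<in> B \<Longrightarrow> r b \<in> bihom n j" "\<And>b t. b \<in> B \<Longrightarrow> t \<noteq> 0 \<Longrightarrow>
      poly b (Const t * z) - Const (inverse t) * poly (r b) (Const t * z) \<in> W t"
  proof -
    have "\<forall>b\<in>B. \<exists>r. r \<in> bihom n j \<and> (\<forall>t. t \<noteq> 0 \<longrightarrow>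
        poly b (Const t * z) - Const (inverse t) * poly r (Const t * z) \<in> W t)"
      by (intro ballI step) (rule subsetD [OF B(2)])
    from bchoice [OF this] show ?thesis using that by auto
  qed
  obtain M where M: "\<And>b. b \<in> B \<Longrightarrow> r b = (\<Sum>b'\<in>B. smult (Const (M b b')) b')"
  proof -
    have "\<forall>b\<in>B. \<exists>c. r b = (\<Sum>b'\<in>B. smult (Const (c b')) b')"
      by (intro ballI B(3) r(1))
    from bchoice [OF this] show ?thesis using that by auto
  qed
  \<comment> \<open>The matrix 1 - u M is the identity at u = 0, as
    \<open>generic_elimination\<close> requires. The value 0 itself is no inverse of a t and joins
    the exceptions below.\<close>
  define P where "P b b' = [:if b = b' then 1 else 0, - M b b':]" for b b'
  have P0: "poly (P b b') 0 = (if b = b' then 1 else 0)" for b b' by (simp add: P_def)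
  from mp.generic_elimination [OF B(1) P0]
  obtain F where F: "finite F \<and> (\<forall>t Q e. t \<notin> F \<longrightarrow> mp.subspace Q \<longrightarrow>
      (\<forall>b\<in>B. (\<Sum>b'\<in>B. Const (poly (P b b') t) * e b') \<in> Q) \<longrightarrow> (\<forall>b\<in>B. e b \<in> Q))"
    by (rule exE)
  show ?thesis
  proof (intro exI [of _ "insert 0 F"] conjI allI impI ballI)
    show "finite (insert 0 F)" using F by simp
    fix u and f :: "'k mpoly" assume u: "u \<notin> insert 0 F" and f: "f \<in> homog n j"
    let ?t = "inverse u"
    have "(\<Sum>b'\<in>B. Const (poly (P b b') u) * poly b' (Const ?t * z)) \<in> W ?t" if b: "b \<in> B" for b
    proof -
      have "(\<Sum>b'\<in>B. Const (poly (P b b') u) * poly b' (Const ?t * z)) =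
          (\<Sum>b'\<in>B. (if b = b' then poly b' (Const ?t * z) else 0) -
             Const u * (Const (M b b') * poly b' (Const ?t * z)))"
        by (intro sum.cong refl)
           (auto simp: P_def algebra_simps Const_diff Const_mult Const_uminus)
      also have "\<dots> = poly b (Const ?t * z) - Const (inverse ?t) * poly (r b) (Const ?t * z)"
        using B(1) b by (simp add: sum_subtractf M [OF b] poly_sum sum_distrib_left)
      also have "\<dots> \<in> W ?t" using r(2) [OF b, of ?t] u by auto
      finally show ?thesis .
    qed
    then have *: "\<forall>b\<in>B. poly b (Const ?t * z) \<in> W ?t"
      using F [THEN conjunct2, THEN spec [of _ u], THEN spec [of _ "W ?t"],
          THEN spec [of _ "\<lambda>b. poly b (Const ?t * z)"]] u W by simp
    obtain c where "monom f 0 = (\<Sum>b\<in>B. smult (Const (c b)) b)"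
      using B(3) [OF bihom_monom [OF f]] by auto
    then have "poly (monom f 0) (Const ?t * z) = (\<Sum>b\<in>B. Const (c b) * poly b (Const ?t * z))"
      by (simp add: poly_sum)
    moreover have "\<dots> \<in> W ?t"
      using * by (auto intro!: mp.subspace_sum [OF W] mp.subspace_scale [OF W])
    ultimately have "f \<in> W ?t" by (simp add: poly_monom)
    then show "\<exists>h. (if N \<le> j then h \<in> homog n (j - N) else h = 0) \<and>
        f - (y + Const ?t * z) ^ N * h \<in> gen_ideal n g" by (simp add: W_def)
  qed
qed

section \<open>Hessenberg ideals\<close>

lemma power_diff_gen_ideal:
  assumes "y - y' \<in> gen_ideal n g" "y \<in> polyring n" "y' \<in> polyring n"
  shows "y ^ N - y' ^ N \<in> gen_ideal n g"
proof (induction N)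
  case (Suc N)
  have "y ^ Suc N - y' ^ Suc N = y * (y ^ N - y' ^ N) + (y - y') * y' ^ N"
    by (simp add: algebra_simps)
  also have "\<dots> \<in> gen_ideal n g"
    by (intro gen_ideal_add gen_ideal_mult gen_ideal_mult' Suc assms polyring_power)
  finally show ?case .
qed simp

text \<open>Congruent forms have congruent powers. Thus the coefficient in \<open>y\<close> of a
  variable lying in the ideal may be changed freely.\<close>

lemma Surj_cong:
  fixes y :: "'k::comm_ring_1 mpoly"
  assumes S: "Surj n (gen_ideal n g) y c" and yy: "y - y' \<in> gen_ideal n g"
    and y: "y \<in> polyring n" "y' \<in> polyring n"
  shows "Surj n (gen_ideal n g) y' c"
  unfolding Surj_def
proof (intro conjI allI impI ballI)
  show "homog n j \<subseteq> gen_ideal n g" if "c < j" for j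
    using S that by (auto simp: Surj_def)
  fix i and f :: "'k mpoly" assume i: "2 * i \<le> c" and f: "f \<in> homog n (c - i)"
  with S obtain h where h: "h \<in> homog n i" "f - y ^ (c - 2 * i) * h \<in> gen_ideal n g"
    unfolding Surj_def by blast
  have "(y ^ (c - 2 * i) - y' ^ (c - 2 * i)) * h \<in> gen_ideal n g"
    by (intro gen_ideal_mult' power_diff_gen_ideal yy y homog_polyring [OF h(1)])
  from gen_ideal_add [OF h(2) this]
  have "f - y' ^ (c - 2 * i) * h \<in> gen_ideal n g" by (simp add: algebra_simps)
  with h(1) show "\<exists>h\<in>homog n i. f - y' ^ (c - 2 * i) * h \<in> gen_ideal n g" by blast
qed

lemma finite_exceptions:
  assumes "finite X" "\<And>x. x \<in> X \<Longrightarrow> \<exists>F. finite F \<and> (\<forall>u. u \<notin> F \<longrightarrow> P x u)"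
  shows "\<exists>F. finite F \<and> (\<forall>u. u \<notin> F \<longrightarrow> (\<forall>x\<in>X. P x u))"
proof -
  from assms(2) have "\<forall>x\<in>X. \<exists>F. finite F \<and> (\<forall>u. u \<notin> F \<longrightarrow> P x u)" by blast
  from bchoice [OF this] obtain F where "\<forall>x\<in>X. finite (F x) \<and> (\<forall>u. u \<notin> F x \<longrightarrow> P x u)" by blast
  with assms(1) show ?thesis by (intro exI [of _ "\<Union>(F ` X)"]) auto
qed

text \<open>Over a field, \<open>nonzero\<close> says that all principal minors of the Hessenberg matrix \<open>A\<close>
  are nonzero.\<close>

locale hessenberg =
  fixes n :: nat and d :: "nat \<Rightarrow> nat" and A :: "nat \<Rightarrow> nat \<Rightarrow> 'k::field_char_0"
  assumes hess: "Suc i < j \<Longrightarrow> A i j = 0"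
    and nonzero: "i < n \<Longrightarrow> v i \<noteq> 0 \<Longrightarrow> \<exists>i<n. v i \<noteq> 0 \<and> (\<Sum>j<n. A i j * v j) \<noteq> 0"
    and d_pos: "i < n \<Longrightarrow> 0 < d i"
begin

text \<open>Modulo the variables below \<open>m\<close> this is again an ideal of the same shape, in the variables
  from \<open>m\<close> on, except that the first exponent \<open>e\<close> may be \<open>0\<close>.\<close>

definition tail_gens :: "nat \<Rightarrow> nat \<Rightarrow> nat \<Rightarrow> 'k mpoly" where
  "tail_gens m e i = (if i < m then Var i else Var i ^ (d(m := e)) i * lin n (A i))"

abbreviation tail :: "nat \<Rightarrow> nat \<Rightarrow> 'k mpoly set" where
  "tail m e \<equiv> gen_ideal n (tail_gens m e)"

text \<open>The expected socle degree of the complete intersection: a generator of degree k + 1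
  contributes k, so the variables below \<open>m\<close> contribute nothing.\<close>

definition tail_deg :: "nat \<Rightarrow> nat \<Rightarrow> nat" where
  "tail_deg m e = sum (d(m := e)) {m..<n}"

lemma tail_gens_homog: "i < n \<Longrightarrow> \<exists>b. tail_gens m e i \<in> homog n b"
  unfolding tail_gens_def
  using homog_Var [of i n] homog_mult [OF homog_power1 [OF homog_Var [of i n]] lin_homog]
  by (cases "i < m") (simp_all only: if_True if_False simp_thms, blast+)

lemma tail_Var: "i < m \<Longrightarrow> i < n \<Longrightarrow> Var i \<in> tail m e"
  using gen_ideal_gen [of i n "tail_gens m e"] by (simp add: tail_gens_def)

lemma tail_gen: "m \<le> i \<Longrightarrow> i < n \<Longrightarrow> Var i ^ (d(m := e)) i * lin n (A i) \<in> tail m e"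
  using gen_ideal_gen [of i n "tail_gens m e"] by (simp add: tail_gens_def)

text \<open>The two ideals differ only in generator \<open>l\<close>, so removing the multiple of
  \<open>Var l\<close> leaves an element of \<open>tail l e'\<close>, whatever \<open>e'\<close> is.
  This separates one layer x_l C of the filtration from the preceding ones.\<close>

lemma tail_Suc_split:
  assumes f: "f \<in> tail (Suc l) e" "f \<in> homog n a" and l: "l < n" and e: "e = d (Suc l)"
  obtains r f' where "f = Var l * r + f'" "f' \<in> tail l e'" "f' \<in> homog n a"
    "a = 0 \<Longrightarrow> r = 0" "0 < a \<Longrightarrow> r \<in> homog n (a - 1)"
proof -
  obtain u where u: "\<forall>i<n. u i \<in> polyring n" "f = (\<Sum>i<n. u i * tail_gens (Suc l) e i)"
    using f(1) by (auto simp: gen_ideal_def)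
  define f' where "f' = (\<Sum>i\<in>{..<n} - {l}. u i * tail_gens (Suc l) e i)"
  have f': "f' \<in> tail l e'"
    unfolding f'_def
  proof (intro gen_ideal_sum gen_ideal_mult)
    fix i assume "i \<in> {..<n} - {l}"
    moreover from this have "tail_gens (Suc l) e i = tail_gens l e' i"
      by (auto simp: tail_gens_def e)
    ultimately show "tail_gens (Suc l) e i \<in> tail l e'" "u i \<in> polyring n"
      using u(1) by (auto intro: gen_ideal_gen)
  qed
  have eq: "f = u l * Var l + f'"
    unfolding u(2) f'_def using l by (subst sum.remove [of _ l]) (auto simp: tail_gens_def)
  define r where "r = (if a = 0 then 0 else hcomp (a - 1) (u l))"
  have "hcomp a f = Var l * r + hcomp a f'"
    unfolding eq hcomp_add using hcomp_mult_homog [OF u(1) [rule_format, OF l] homog_Var [OF l], of a]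
    by (auto simp: r_def mult.commute)
  then have "f = Var l * r + hcomp a f'"
    using hcomp_homog [OF f(2), of a] by simp
  moreover have "hcomp a f' \<in> tail l e'"
    by (rule gen_ideal_hcomp [OF tail_gens_homog f'])
  moreover have "hcomp a f' \<in> homog n a"
  proof (rule hcomp_in_homog, rule gen_ideal_polyring [OF _ f'])
    show "tail_gens l e' i \<in> polyring n" if "i < n" for i
      using tail_gens_homog [OF that] homog_polyring by blast
  qed
  moreover have "r \<in> homog n (a - 1)" using u(1) l by (auto simp: r_def intro: hcomp_in_homog)
  ultimately show thesis by (intro that [of r "hcomp a f'"]) (auto simp: r_def)
qed

text \<open>The exponent D_j, counted from the variable \<open>m\<close> and with first exponent
  \<open>e\<close>.\<close>

definition level :: "nat \<Rightarrow> nat \<Rightarrow> nat \<Rightarrow> nat" where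
  "level m e j = sum (d(m := e)) {m..<j}"

lemma level_mono: "i \<le> j \<Longrightarrow> level m e i \<le> level m e j"
  unfolding level_def by (rule sum_mono2) auto

lemma level_Suc: "m \<le> j \<Longrightarrow> level m e (Suc j) = level m e j + (d(m := e)) j"
  by (simp add: level_def)

lemma level_refl [simp]: "level m e m = 0"
  by (simp add: level_def)

lemma tail_deg_level:
  assumes "m < l" "l \<le> n"
  shows "tail_deg m e = level m e l + tail_deg l (d l)"
proof -
  have "{m..<n} = {m..<l} \<union> {l..<n}" using assms by auto
  then have "tail_deg m e = sum (d(m := e)) {m..<l} + sum (d(m := e)) {l..<n}"
    unfolding tail_deg_def by (simp add: sum.union_disjoint)
  also have "sum (d(m := e)) {l..<n} = sum (d(l := d l)) {l..<n}"
    using assms by (intro sum.cong) auto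
  finally show ?thesis by (simp add: level_def tail_deg_def)
qed

lemma tail_deg_first: "m < n \<Longrightarrow> tail_deg m e = e + sum d {Suc m..<n}"
  unfolding tail_deg_def by (subst sum.atLeast_Suc_lessThan) (auto intro: sum.cong)

lemma power_mult_tail:
  assumes "Var m ^ k * f \<in> tail m e" "k \<le> k'" "m < n"
  shows "Var m ^ k' * f \<in> tail m e"
proof -
  have "Var m ^ k' * f = Var m ^ (k' - k) * (Var m ^ k * f)"
    using assms(2) by (simp add: mult.assoc [symmetric] power_add [symmetric])
  also have "\<dots> \<in> tail m e"
    by (rule gen_ideal_mult [OF assms(1)]) (use assms in \<open>auto intro: polyring_power\<close>)
  finally show ?thesis .
qed

text \<open>After multiplication by x_m^(D_j), x_j may be replaced by v x_m. The generator x_j^k l_j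
  therefore gives v^k x_m^(D_j + k) l_j, and v is invertible.\<close>

lemma level_lin_tail:
  assumes m: "m \<le> j" "j < n" and v: "v \<noteq> 0"
    and mem: "Var m ^ level m e j * (Var j - Const v * Var m) \<in> tail m e"
  shows "Var m ^ level m e (Suc j) * lin n (A j) \<in> tail m e"
proof -
  let ?z = "Var m :: 'k mpoly" and ?k = "(d(m := e)) j"
  have pow: "?z ^ level m e j * (Var j ^ k - (Const v * ?z) ^ k) \<in> tail m e" for k
  proof (induction k)
    case (Suc k)
    have "?z ^ level m e j * (Var j ^ Suc k - (Const v * ?z) ^ Suc k) =
      Var j * (?z ^ level m e j * (Var j ^ k - (Const v * ?z) ^ k)) +
      (Const v * ?z) ^ k * (?z ^ level m e j * (Var j - Const v * ?z))"
      by (simp add: algebra_simps)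
    also have "\<dots> \<in> tail m e"
      using m by (intro gen_ideal_add gen_ideal_mult [OF Suc] gen_ideal_mult [OF mem] polyring_intros) auto
    finally show ?case .
  qed simp
  have "?z ^ level m e j * (Var j ^ ?k * lin n (A j)) \<in> tail m e"
    using m by (intro gen_ideal_mult tail_gen polyring_power) auto
  moreover have "(?z ^ level m e j * (Var j ^ ?k - (Const v * ?z) ^ ?k)) * lin n (A j) \<in> tail m e"
    by (intro gen_ideal_mult' pow lin_polyring)
  ultimately have "?z ^ level m e j * (Var j ^ ?k * lin n (A j)) -
      (?z ^ level m e j * (Var j ^ ?k - (Const v * ?z) ^ ?k)) * lin n (A j) \<in> tail m e"
    by (rule gen_ideal_diff)
  also have "?z ^ level m e j * (Var j ^ ?k * lin n (A j)) -
      (?z ^ level m e j * (Var j ^ ?k - (Const v * ?z) ^ ?k)) * lin n (A j) =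
      Const (v ^ ?k) * (?z ^ level m e (Suc j) * lin n (A j))"
    using m by (simp add: level_Suc Const_power power_mult_distrib power_add algebra_simps)
  finally show ?thesis
    using gen_ideal_Const [of _ n _ "inverse (v ^ ?k)"] v by (metis Const_inverse_mult power_not_zero)
qed

lemma lin_shift:
  "lin n s - Const (\<Sum>k<n. s k * v k) * z = (\<Sum>k<n. Const (s k) * (Var k - Const (v k) * z))"
  by (simp add: lin_def Const_sum Const_mult sum_distrib_right right_diff_distrib sum_subtractf
      mult.assoc)

text \<open>The entries of \<open>v\<close> are the numbers alpha: the vector starts with 1 at
  \<open>m\<close>, is supported on m, ..., j, and solves the rows before \<open>j\<close>.\<close>

definition chain :: "nat \<Rightarrow> nat \<Rightarrow> nat \<Rightarrow> (nat \<Rightarrow> 'k) \<Rightarrow> bool" where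
  "chain m e j v \<longleftrightarrow> v m = 1 \<and> (\<forall>i. i < m \<or> j < i \<longrightarrow> v i = 0) \<and> (\<forall>i\<in>{m..j}. v i \<noteq> 0) \<and>
    (\<forall>i\<in>{m..<j}. (\<Sum>k<n. A i k * v k) = 0) \<and>
    (\<forall>i\<in>{m..j}. Var m ^ level m e i * (Var i - Const (v i) * Var m) \<in> tail m e)"

text \<open>Row \<open>j\<close> is solved for the next entry; if that were 0, the old vector would
  contradict \<open>nonzero\<close>. In the expansion of x_m^(D_(j+1)) l_j, only the term with
  x_(j+1) is not yet known to lie in the ideal, so it does too.\<close>

lemma chain_exists:
  assumes "m \<le> j" "j < n" "\<And>i. m \<le> i \<Longrightarrow> i < j \<Longrightarrow> A i (Suc i) \<noteq> 0"
  shows "\<exists>v. chain m e j v"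
  using assms
proof (induction j rule: dec_induct)
  case base
  show ?case by (rule exI [of _ "\<lambda>i. if i = m then 1 else 0"]) (auto simp: chain_def)
next
  case (step j)
  from step.IH step.prems obtain v where "chain m e j v" by auto
  then have vm: "v m = 1" and v0: "\<And>i. i < m \<or> j < i \<Longrightarrow> v i = 0"
    and vnz: "\<And>i. m \<le> i \<Longrightarrow> i \<le> j \<Longrightarrow> v i \<noteq> 0"
    and ker: "\<And>i. m \<le> i \<Longrightarrow> i < j \<Longrightarrow> (\<Sum>k<n. A i k * v k) = 0"
    and mem: "\<And>i. m \<le> i \<Longrightarrow> i \<le> j \<Longrightarrow> Var m ^ level m e i * (Var i - Const (v i) * Var m) \<in> tail m e" for i
    by (auto simp: chain_def)
  define S where "S = (\<Sum>k<n. A j k * v k)"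
  define w where "w = v(Suc j := - S / A j (Suc j))"
  have Anz: "A j (Suc j) \<noteq> 0" using step by auto
  have w: "(\<Sum>k<n. A i k * w k) = (\<Sum>k<n. A i k * v k) - A i (Suc j) * S / A j (Suc j)" for i
    using step.prems v0 [of "Suc j"]
    by (simp add: w_def sum.remove [of "{..<n}" "Suc j"] algebra_simps)
  have wker: "(\<Sum>k<n. A i k * w k) = 0" if "m \<le> i" "i < Suc j" for i
  proof (cases "i = j")
    case True
    then show ?thesis using Anz by (simp add: w S_def)
  next
    case False
    then show ?thesis using that by (simp add: w ker hess)
  qed
  have wnz: "w i \<noteq> 0" if "m \<le> i" "i \<le> Suc j" for i
  proof (cases "i = Suc j")
    case True
    show ?thesis
    proof
      assume "w i = 0"
      then have "S = 0" using True Anz by (simp add: w_def)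
      have "m < n" "v m \<noteq> 0" using step vm by auto
      from nonzero [of m v, OF this] obtain i where
        i: "i < n" "v i \<noteq> 0" "(\<Sum>k<n. A i k * v k) \<noteq> 0" by blast
      then have "m \<le> i" "i \<le> j" using v0 by (meson not_le)+
      with i ker \<open>S = 0\<close> show False by (cases "i = j") (auto simp: S_def)
    qed
  qed (use vnz that in \<open>auto simp: w_def\<close>)
  have wmem_le: "Var m ^ level m e i * (Var i - Const (w i) * Var m) \<in> tail m e"
    if "m \<le> i" "i \<le> j" for i using mem that by (auto simp: w_def)
  let ?E = "level m e (Suc j)"
  have term_mem: "Const (A j k) * (Var m ^ ?E * (Var k - Const (w k) * Var m)) \<in> tail m e"
    if k: "k \<in> {..<n} - {Suc j}" for k
  proof -
    consider "k < m" | "m \<le> k" "k \<le> j" | "Suc j < k" using k by fastforce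
    then show ?thesis
    proof cases
      case 1
      then have "w k = 0" using v0 step by (simp add: w_def)
      with 1 k step show ?thesis
        by (auto intro!: gen_ideal_mult gen_ideal_Const tail_Var polyring_power)
    next
      case 2
      then show ?thesis using step
        by (intro gen_ideal_Const power_mult_tail [OF wmem_le] level_mono) auto
    qed (simp add: hess)
  qed
  have "Var m ^ ?E * lin n (A j) =
      (\<Sum>k<n. Const (A j k) * (Var m ^ ?E * (Var k - Const (w k) * Var m)))"
    using lin_shift [of "A j" w "Var m"] wker [of j] step
    by (simp add: sum_distrib_left mult.left_commute)
  also have "\<dots> = Const (A j (Suc j)) * (Var m ^ ?E * (Var (Suc j) - Const (w (Suc j)) * Var m)) +
      (\<Sum>k\<in>{..<n} - {Suc j}. Const (A j k) * (Var m ^ ?E * (Var k - Const (w k) * Var m)))"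
    using step by (subst sum.remove [of _ "Suc j"]) auto
  finally have "Const (A j (Suc j)) * (Var m ^ ?E * (Var (Suc j) - Const (w (Suc j)) * Var m)) =
      Var m ^ ?E * lin n (A j) -
      (\<Sum>k\<in>{..<n} - {Suc j}. Const (A j k) * (Var m ^ ?E * (Var k - Const (w k) * Var m)))"
    by simp
  also have "\<dots> \<in> tail m e"
    using step vnz mem
    by (intro gen_ideal_diff gen_ideal_sum term_mem level_lin_tail [of _ _ "v j"]) auto
  finally have "Var m ^ ?E * (Var (Suc j) - Const (w (Suc j)) * Var m) \<in> tail m e"
    using gen_ideal_Const [of _ n _ "inverse (A j (Suc j))"] Anz by (metis Const_inverse_mult)
  with wmem_le have wmem: "Var m ^ level m e i * (Var i - Const (w i) * Var m) \<in> tail m e"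
    if "m \<le> i" "i \<le> Suc j" for i
    using that by (cases "i = Suc j") auto
  show ?case
    using wker wnz wmem vm v0 step
    by (intro exI [of _ w]) (auto simp: w_def chain_def)
qed

text \<open>The chain ends at the first row whose superdiagonal entry vanishes, or at the last row.
  There \<open>nonzero\<close> gives the row a nonzero value \<open>S\<close> on \<open>v\<close>,
  and the same expansion yields S x_m^(D_(q+1) + 1) in the ideal.\<close>

lemma chain_top:
  assumes m: "m < n"
  obtains q v where "m \<le> q" "q < n"
    "\<And>i. m \<le> i \<Longrightarrow> i \<le> q \<Longrightarrow> Var m ^ level m e i * (Var i - Const (v i) * Var m) \<in> tail m e"
    "Var m ^ Suc (level m e (Suc q)) \<in> tail m e"
proof -
  define last where "last q \<longleftrightarrow> m \<le> q \<and> q < n \<and> (Suc q = n \<or> A q (Suc q) = 0)" for q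
  define q where "q = (LEAST q. last q)"
  have "last (n - 1)" using m by (auto simp: last_def)
  then have q: "last q" unfolding q_def by (rule LeastI)
  have sup: "A i (Suc i) \<noteq> 0" if "m \<le> i" "i < q" for i
  proof -
    have "\<not> last i" using that not_less_Least unfolding q_def by blast
    then show ?thesis using that q by (auto simp: last_def)
  qed
  from chain_exists [of m q e] q sup obtain v where "chain m e q v"
    by (auto simp: last_def)
  then have vm: "v m = 1"
    and v0: "\<And>i. i < m \<or> q < i \<Longrightarrow> v i = 0"
    and vnz: "\<And>i. m \<le> i \<Longrightarrow> i \<le> q \<Longrightarrow> v i \<noteq> 0"
    and ker: "\<And>i. m \<le> i \<Longrightarrow> i < q \<Longrightarrow> (\<Sum>k<n. A i k * v k) = 0"
    and mem: "\<And>i. m \<le> i \<Longrightarrow> i \<le> q \<Longrightarrow> Var m ^ level m e i * (Var i - Const (v i) * Var m) \<in> tail m e" for i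
    by (auto simp: chain_def)
  define S where "S = (\<Sum>k<n. A q k * v k)"
  have "S \<noteq> 0"
  proof
    assume "S = 0"
    from nonzero [of m v] m vm obtain i where
      i: "i < n" "v i \<noteq> 0" "(\<Sum>k<n. A i k * v k) \<noteq> 0" by auto
    then have "m \<le> i" "i \<le> q" using v0 by (meson not_le)+
    with i ker \<open>S = 0\<close> show False by (cases "i = q") (auto simp: S_def)
  qed
  let ?E = "level m e (Suc q)"
  have "Const (A q k) * (Var m ^ ?E * (Var k - Const (v k) * Var m)) \<in> tail m e"
    if k: "k < n" for k
  proof -
    consider "k < m" | "m \<le> k" "k \<le> q" | "k = Suc q" | "Suc q < k" by fastforce
    then show ?thesis
    proof cases
      case 1
      with k m v0 show ?thesis
        by (auto intro!: gen_ideal_mult gen_ideal_Const tail_Var polyring_power)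
    next
      case 2
      then show ?thesis using m
        by (intro gen_ideal_Const power_mult_tail [OF mem] level_mono) auto
    next
      case 3
      then show ?thesis using q k by (simp add: last_def)
    qed (simp add: hess)
  qed
  then have "(\<Sum>k<n. Const (A q k) * (Var m ^ ?E * (Var k - Const (v k) * Var m))) \<in> tail m e"
    by (intro gen_ideal_sum) auto
  moreover have "(\<Sum>k<n. Const (A q k) * (Var m ^ ?E * (Var k - Const (v k) * Var m))) =
      Var m ^ ?E * (lin n (A q) - Const S * Var m)"
    unfolding S_def lin_shift by (simp add: sum_distrib_left mult.left_commute)
  ultimately have "Var m ^ ?E * (lin n (A q) - Const S * Var m) \<in> tail m e" by simp
  moreover have "Var m ^ ?E * lin n (A q) \<in> tail m e"
    using q vnz mem by (intro level_lin_tail [of _ _ "v q"]) (auto simp: last_def)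
  ultimately have "Var m ^ ?E * lin n (A q) - Var m ^ ?E * (lin n (A q) - Const S * Var m) \<in> tail m e"
    by (intro gen_ideal_diff)
  also have "Var m ^ ?E * lin n (A q) - Var m ^ ?E * (lin n (A q) - Const S * Var m) =
      Const S * Var m ^ Suc ?E"
    by (simp add: algebra_simps)
  finally have "Var m ^ Suc ?E \<in> tail m e"
    using gen_ideal_Const [of _ n _ "inverse S"] \<open>S \<noteq> 0\<close> by (metis Const_inverse_mult)
  with q mem that show thesis by (auto simp: last_def)
qed

section \<open>The associated graded ring and its filtration\<close>

text \<open>The polynomials \<open>f\<close> for which \<open>x\<^sub>m\<^sup>k f\<close> vanishes in degree \<open>k\<close> of the associated graded ring
  of the \<open>x\<^sub>m\<close>-adic filtration.\<close>

definition initial :: "nat \<Rightarrow> nat \<Rightarrow> nat \<Rightarrow> 'k mpoly set" where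
  "initial m e k = {f. \<exists>r\<in>polyring n. Var m ^ k * f - Var m ^ Suc k * r \<in> tail m e}"

lemma initial_0 [simp]: "0 \<in> initial m e k"
  unfolding initial_def by (rule CollectI, rule bexI [of _ 0]) auto

lemma initial_add: "f \<in> initial m e k \<Longrightarrow> f' \<in> initial m e k \<Longrightarrow> f + f' \<in> initial m e k"
proof -
  assume "f \<in> initial m e k" "f' \<in> initial m e k"
  then obtain r r' where r: "r \<in> polyring n" "Var m ^ k * f - Var m ^ Suc k * r \<in> tail m e"
    "r' \<in> polyring n" "Var m ^ k * f' - Var m ^ Suc k * r' \<in> tail m e"
    unfolding initial_def by blast
  have "Var m ^ k * (f + f') - Var m ^ Suc k * (r + r') \<in> tail m e"
    using gen_ideal_add [OF r(2,4)] by (simp add: algebra_simps)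
  with r show ?thesis unfolding initial_def by (auto intro: polyring_add)
qed

lemma initial_mult: "f \<in> initial m e k \<Longrightarrow> u \<in> polyring n \<Longrightarrow> u * f \<in> initial m e k"
proof -
  assume u: "u \<in> polyring n" and "f \<in> initial m e k"
  then obtain r where r: "r \<in> polyring n" "Var m ^ k * f - Var m ^ Suc k * r \<in> tail m e"
    unfolding initial_def by blast
  have "Var m ^ k * (u * f) - Var m ^ Suc k * (u * r) \<in> tail m e"
    using gen_ideal_mult [OF r(2) u] by (simp add: algebra_simps)
  with r u show ?thesis unfolding initial_def by (auto intro: polyring_mult)
qed

lemma initial_sum:
  "(\<And>x. x \<in> X \<Longrightarrow> f x \<in> initial m e k) \<Longrightarrow> (\<Sum>x\<in>X. f x) \<in> initial m e k"
  by (induction X rule: infinite_finite_induct) (auto intro: initial_add)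

text \<open>For m <= i <= l, x_m^k x_i is congruent to v_i x_m^(k+1), hence zero in degree k of the
  graded ring. The other generators lie in \<open>tail m e\<close> already.\<close>

lemma tail_initial:
  assumes m: "m \<le> l" "l < n" and k: "level m e l \<le> k"
    and mem: "\<And>i. m \<le> i \<Longrightarrow> i \<le> l \<Longrightarrow> Var m ^ level m e i * (Var i - Const (v i) * Var m) \<in> tail m e"
    and f: "f \<in> tail (Suc l) (d (Suc l))"
  shows "f \<in> initial m e k"
proof -
  obtain u where u: "\<forall>i<n. u i \<in> polyring n" "f = (\<Sum>i<n. u i * tail_gens (Suc l) (d (Suc l)) i)"
    using f by (auto simp: gen_ideal_def)
  have "tail_gens (Suc l) (d (Suc l)) i \<in> initial m e k" if i: "i < n" for i
  proof -
    consider "i < m" | "m \<le> i" "i \<le> l" | "l < i" by linarith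
    then show ?thesis
    proof cases
      case 1
      then show ?thesis using m i unfolding initial_def
        by (intro CollectI bexI [of _ 0])
           (auto simp: tail_gens_def intro!: gen_ideal_mult tail_Var polyring_power)
    next
      case 2
      have "Var m ^ k * (Var i - Const (v i) * Var m) \<in> tail m e"
        using 2 m k level_mono [of i l m e] by (intro power_mult_tail [OF mem]) auto
      then show ?thesis using 2 unfolding initial_def
        by (intro CollectI bexI [of _ "Const (v i)"])
           (auto simp: tail_gens_def algebra_simps)
    next
      case 3
      then show ?thesis using m i tail_gen [of m i e] unfolding initial_def
        by (intro CollectI bexI [of _ 0])
           (auto simp: tail_gens_def intro!: gen_ideal_mult polyring_power)
    qed
  qed
  then show ?thesis using u by (auto intro!: initial_sum initial_mult)
qed

text \<open>Supplies the covering hypothesis of \<open>generic_spanning\<close>. The filtration is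
  climbed from \<open>tail (Suc m)\<close>, which vanishes in all degrees of the graded ring, to the
  whole ring, with one use of \<open>string_span\<close> per layer.\<close>

lemma degenerate_cover:
  assumes m: "m < n" and y: "y \<in> homog n 1"
    and IH: "\<And>l e'. m < l \<Longrightarrow> l \<le> n \<Longrightarrow> e' \<le> d l \<Longrightarrow> Surj n (tail l e') y (tail_deg l e')"
    and j: "tail_deg m e \<le> 2 * j" and N: "N = 2 * j - tail_deg m e"
    and p: "p \<in> bihom n j"
  shows "\<exists>h s. (if N \<le> j then h \<in> bihom n (j - N) else h = 0) \<and>
      p = [:y, 1:] ^ N * h + s \<and> (\<forall>k. coeff s k \<in> initial m e k)"
proof -
  define Q where "Q = {p. \<exists>h s. (if N \<le> j then h \<in> bihom n (j - N) else h = 0) \<and>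
      p = [:y, 1:] ^ N * h + s \<and> (\<forall>k. coeff s k \<in> initial m e k)}"
  have QI: "[:y, 1:] ^ N * h + s \<in> Q"
    if "if N \<le> j then h \<in> bihom n (j - N) else h = 0" "\<And>k. coeff s k \<in> initial m e k" for h s
    unfolding Q_def using that by blast
  have Q: "mpp.subspace Q"
  proof (rule mpp.subspaceI)
    show "0 \<in> Q" using QI [of 0 0] by simp
    show "p + p' \<in> Q" if p: "p \<in> Q" "p' \<in> Q" for p p'
    proof -
      from p obtain h s h' s' where *: "if N \<le> j then h \<in> bihom n (j - N) else h = 0"
        "p = [:y, 1:] ^ N * h + s" "\<forall>k. coeff s k \<in> initial m e k"
        "if N \<le> j then h' \<in> bihom n (j - N) else h' = 0"
        "p' = [:y, 1:] ^ N * h' + s'" "\<forall>k. coeff s' k \<in> initial m e k"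
        unfolding Q_def by blast
      have "[:y, 1:] ^ N * (h + h') + (s + s') \<in> Q"
        by (rule QI) (use * in \<open>auto intro: bihom_add initial_add split: if_splits\<close>)
      also have "[:y, 1:] ^ N * (h + h') + (s + s') = p + p'"
        unfolding *(2,5) by (simp only: distrib_left add_ac)
      finally show ?thesis .
    qed
    show "smult (Const c) p \<in> Q" if p: "p \<in> Q" for c p
    proof -
      from p obtain h s where *: "if N \<le> j then h \<in> bihom n (j - N) else h = 0"
        "p = [:y, 1:] ^ N * h + s" "\<forall>k. coeff s k \<in> initial m e k"
        unfolding Q_def by blast
      have "[:y, 1:] ^ N * smult (Const c) h + smult (Const c) s \<in> Q"
        by (rule QI) (use * in \<open>auto intro: bihom_smult initial_mult split: if_splits\<close>)
      also have "[:y, 1:] ^ N * smult (Const c) h + smult (Const c) s = smult (Const c) p"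
        unfolding *(2) by (simp add: smult_add_right)
      finally show ?thesis .
    qed
  qed
  have img: "[:y, 1:] ^ N * h \<in> Q" if "N \<le> j" "h \<in> bihom n (j - N)" for h
    using QI [of h 0] that by simp
  have init: "monom f k \<in> Q" if "f \<in> initial m e k" for f k
  proof -
    have "[:y, 1:] ^ N * 0 + monom f k \<in> Q"
      by (rule QI) (use that in auto)
    then show ?thesis by simp
  qed
  obtain q v where q: "m \<le> q" "q < n"
    and v: "\<And>i. m \<le> i \<Longrightarrow> i \<le> q \<Longrightarrow> Var m ^ level m e i * (Var i - Const (v i) * Var m) \<in> tail m e"
    and ztop: "Var m ^ Suc (level m e (Suc q)) \<in> tail m e"
    using chain_top [OF m] by blast
  have tail_init: "f \<in> initial m e k"
    if "m \<le> l" "l \<le> q" "level m e l \<le> k" "f \<in> tail (Suc l) (d (Suc l))" for l f k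
    using tail_initial [of m l e k v f] that v q by auto
  \<comment> \<open>The layer added at \<open>Suc l\<close> is x_(l+1) times a quotient ring,
    tensored with K[w]/(w^D), D being the level of \<open>Suc l\<close>.\<close>
  have P: "\<forall>f a k. f \<in> tail (Suc l) (d (Suc l)) \<longrightarrow> f \<in> homog n a \<longrightarrow> k + a = j \<longrightarrow> monom f k \<in> Q"
    if "m \<le> l" "l \<le> q" for l
    using that
  proof (induction l rule: dec_induct)
    case base
    then show ?case using tail_init [of m] q init by auto
  next
    case (step l)
    let ?l = "Suc l"
    show ?case
    proof (intro allI impI)
      fix f a k
      assume f: "f \<in> tail (Suc ?l) (d (Suc ?l))" "f \<in> homog n a" and k: "k + a = j"
      have l: "?l < n" using step q by auto
      obtain r f' where rf: "f = Var ?l * r + f'" "f' \<in> tail ?l (d ?l)" "f' \<in> homog n a"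
        "a = 0 \<Longrightarrow> r = 0" "0 < a \<Longrightarrow> r \<in> homog n (a - 1)"
        using tail_Suc_split [OF f l refl, of "d ?l"] by blast
      have "monom (Var ?l * r) k \<in> Q"
      proof (cases "a = 0")
        case True
        then show ?thesis using rf init [of 0 k] by simp
      next
        case False
        have dl: "0 < d ?l" using d_pos l by auto
        show ?thesis
        proof (rule string_span [where \<delta> = 1 and D = "level m e ?l" and
              g = "tail_gens ?l (d ?l - 1)" and e = "tail_deg ?l (d ?l - 1)" and N = N and j = j])
          show "Surj n (tail ?l (d ?l - 1)) y (tail_deg ?l (d ?l - 1))"
            by (rule IH) (use step l in auto)
          show "N + tail_deg ?l (d ?l - 1) + level m e ?l + 2 * 1 = 2 * j + 1"
            using tail_deg_level [of m ?l e] tail_deg_first [of ?l "d ?l"]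
              tail_deg_first [of ?l "d ?l - 1"] step l j N dl by auto
          \<comment> \<open>Multiplication by the variable sends the ideal with exponent
            \<open>d ?l - 1\<close> into the one with exponent \<open>d ?l\<close>; so the layer is
            a quotient of the ring with decreased exponent.\<close>
          show "monom (Var ?l * f) k \<in> Q"
            if "f \<in> tail ?l (d ?l - 1)" "f \<in> homog n a" "k + 1 + a = j" for f a k
          proof -
            from that(1) obtain u where u: "\<forall>i<n. u i \<in> polyring n"
              "f = (\<Sum>i<n. u i * tail_gens ?l (d ?l - 1) i)"
              by (auto simp: gen_ideal_def)
            have *: "Var ?l * tail_gens ?l (d ?l - 1) i \<in> tail ?l (d ?l)" if i: "i < n" for i
            proof (cases "i = ?l")
              case True
              have "Var ?l * tail_gens ?l (d ?l - 1) ?l = tail_gens ?l (d ?l) ?l"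
                using dl by (simp add: tail_gens_def power_eq_if)
              with True show ?thesis using gen_ideal_gen [OF i, of "tail_gens ?l (d ?l)"] by simp
            next
              case False
              then have "tail_gens ?l (d ?l - 1) i = tail_gens ?l (d ?l) i"
                by (simp add: tail_gens_def)
              then show ?thesis using l gen_ideal_mult [OF gen_ideal_gen [OF i, of "tail_gens ?l (d ?l)"], of "Var ?l"]
                by simp
            qed
            have "(\<Sum>i<n. u i * (Var ?l * tail_gens ?l (d ?l - 1) i)) \<in> tail ?l (d ?l)"
              by (rule gen_ideal_sum) (use u gen_ideal_mult [OF *] in auto)
            then have "Var ?l * f \<in> tail ?l (d ?l)"
              by (simp add: u(2) sum_distrib_left mult.left_commute)
            moreover have "Var ?l * f \<in> homog n (1 + a)"
              by (intro homog_mult homog_Var l that)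
            ultimately show ?thesis using step that by auto
          qed
          show "monom (Var ?l * f) k \<in> Q"
            if "level m e ?l \<le> k" "f \<in> homog n a" "k + 1 + a = j" for f a k
          proof (rule init, rule tail_init [of ?l])
            show "Var ?l * f \<in> tail (Suc ?l) (d (Suc ?l))"
              using that l by (intro gen_ideal_mult' tail_Var homog_polyring [of f n a]) auto
          qed (use that step in auto)
          show "r \<in> homog n (a - 1)" "k + 1 + (a - 1) = j" using rf False k by auto
        qed (use y Q img homog_Var [OF l] in auto)
      qed
      moreover have "monom f' k \<in> Q" using step rf k by auto
      ultimately show "monom f k \<in> Q"
        unfolding rf(1) add_monom [symmetric] by (rule mpp.subspace_add [OF Q])
    qed
  qed
  \<comment> \<open>The last layer is the quotient by \<open>tail (Suc q)\<close> itself, whence the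
    factor 1 and \<delta> = 0. On it w is nilpotent by \<open>ztop\<close>, which gives D one more
    than the level.\<close>
  have all: "monom f k \<in> Q" if "f \<in> homog n a" "k + a = j" for f a k
  proof -
    have "monom (1 * f) k \<in> Q"
    proof (rule string_span [where \<delta> = 0 and D = "Suc (level m e (Suc q))" and
          g = "tail_gens (Suc q) (d (Suc q))" and e = "tail_deg (Suc q) (d (Suc q))" and N = N and j = j])
      show "Surj n (tail (Suc q) (d (Suc q))) y (tail_deg (Suc q) (d (Suc q)))"
        by (rule IH) (use q in auto)
      show "N + tail_deg (Suc q) (d (Suc q)) + Suc (level m e (Suc q)) + 2 * 0 = 2 * j + 1"
        using tail_deg_level [of m "Suc q" e] q j N by auto
      show "monom (1 * f) k \<in> Q"
        if "f \<in> tail (Suc q) (d (Suc q))" "f \<in> homog n a" "k + 0 + a = j" for f a k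
        using P [OF q(1) order_refl, rule_format, OF that(1,2)] that(3) by simp
      show "monom (1 * f) k \<in> Q"
        if "Suc (level m e (Suc q)) \<le> k" "f \<in> homog n a" "k + 0 + a = j" for f a k
      proof (rule init)
        have "Var m ^ k * 1 \<in> tail m e"
          by (rule power_mult_tail [OF _ that(1) m]) (use ztop in simp)
        then have "Var m ^ k * f \<in> tail m e"
          using gen_ideal_mult' [of "Var m ^ k" n _ f] homog_polyring [OF that(2)] by simp
        then show "1 * f \<in> initial m e k"
          unfolding initial_def by (intro CollectI bexI [of _ 0]) auto
      qed
      show "f \<in> homog n a" "k + 0 + a = j" using that by auto
    qed (use y Q img in auto)
    then show ?thesis by simp
  qed
  have "(\<Sum>k\<le>j. monom (coeff p k) k) \<in> Q"
    by (intro mpp.subspace_sum [OF Q] all [OF bihom_coeff [OF p]]) auto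
  then have "p \<in> Q" using bihom_sum_monom [OF p] by simp
  then show ?thesis by (simp add: Q_def)
qed

text \<open>Finitely many degrees suffice: those from the middle to c + 1, c being the socle degree.
  In degree c + 1 the power c + 2 exceeds the degree, so that instance says that the graded piece
  vanishes; higher degrees follow.\<close>

lemma Surj_generic:
  assumes m: "m < n" and y: "y \<in> homog n 1"
    and IH: "\<And>l e'. m < l \<Longrightarrow> l \<le> n \<Longrightarrow> e' \<le> d l \<Longrightarrow> Surj n (tail l e') y (tail_deg l e')"
  shows "\<exists>F. finite F \<and> (\<forall>u. u \<notin> F \<longrightarrow>
    Surj n (tail m e) (y + Const (inverse u) * Var m) (tail_deg m e))"
proof -
  let ?c = "tail_deg m e"
  define ok where "ok j u \<longleftrightarrow> (\<forall>f\<in>homog n j. \<exists>h.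
      (if 2 * j - ?c \<le> j then h \<in> homog n (j - (2 * j - ?c)) else h = 0) \<and>
      f - (y + Const (inverse u) * Var m) ^ (2 * j - ?c) * h \<in> tail m e)" for j u
  have *: "\<exists>F. finite F \<and> (\<forall>u. u \<notin> F \<longrightarrow> ok j u)"
    if "j \<in> {j. j \<le> Suc ?c \<and> ?c \<le> 2 * j}" for j
    unfolding ok_def using that degenerate_cover [OF m y IH, of e j] m
    by (intro generic_spanning y homog_Var tail_gens_homog) (auto simp: initial_def)
  have "finite {j. j \<le> Suc ?c \<and> ?c \<le> 2 * j}" by (rule finite_subset [of _ "{..Suc ?c}"]) auto
  from finite_exceptions [of _ ok, OF this *]
  obtain F where finF: "finite F" and ok: "\<forall>u. u \<notin> F \<longrightarrow> (\<forall>j\<in>{j. j \<le> Suc ?c \<and> ?c \<le> 2 * j}. ok j u)"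
    by blast
  have F: "\<exists>h. (if 2 * j - ?c \<le> j then h \<in> homog n (j - (2 * j - ?c)) else h = 0) \<and>
      f - (y + Const (inverse u) * Var m) ^ (2 * j - ?c) * h \<in> tail m e"
    if "u \<notin> F" "j \<le> Suc ?c" "?c \<le> 2 * j" "f \<in> homog n j" for u j f
    using ok that unfolding ok_def by blast
  have "Surj n (tail m e) (y + Const (inverse u) * Var m) ?c" if u: "u \<notin> F" for u
    unfolding Surj_def
  proof (intro conjI allI impI ballI)
    have "homog n (Suc ?c + k) \<subseteq> tail m e" for k
    proof (induction k)
      case 0
      show ?case using F [OF u, of "Suc ?c"] by auto
    next
      case (Suc k)
      show ?case
      proof
        fix f :: "'k mpoly" assume "f \<in> homog n (Suc ?c + Suc k)"
        then have "f \<in> homog n (Suc (Suc ?c + k))" by simp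
        then show "f \<in> tail m e"
          by (rule homog_Suc_induct) (use Suc.IH in \<open>auto intro: gen_ideal_mult subspace_gen_ideal\<close>)
      qed
    qed
    then show "homog n j \<subseteq> tail m e" if "?c < j" for j
      using that by (metis add_Suc less_iff_Suc_add)
    fix i and f :: "'k mpoly" assume i: "2 * i \<le> ?c" and f: "f \<in> homog n (?c - i)"
    have e: "2 * (?c - i) - ?c = ?c - 2 * i" "?c - i - (?c - 2 * i) = i" using i by auto
    have "?c - i \<le> Suc ?c" "?c \<le> 2 * (?c - i)" using i by auto
    from F [OF u this f, unfolded e] obtain h where
      "(if ?c - 2 * i \<le> ?c - i then h \<in> homog n i else h = 0) \<and>
       f - (y + Const (inverse u) * Var m) ^ (?c - 2 * i) * h \<in> tail m e" by (rule exE)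
    moreover have "?c - 2 * i \<le> ?c - i" by simp
    ultimately show "\<exists>h\<in>homog n i. f - (y + Const (inverse u) * Var m) ^ (?c - 2 * i) * h \<in> tail m e"
      by (intro bexI [of _ h]) simp_all
  qed
  with finF show ?thesis by blast
qed

end

section \<open>One linear form for all tails\<close>

context hessenberg
begin

lemma Surj_last: "Surj n (tail n e) y (tail_deg n e)"
  unfolding Surj_def
proof (intro conjI allI impI ballI)
  show "homog n j \<subseteq> tail n e" if "tail_deg n e < j" for j
  proof
    fix f :: "'k mpoly" assume "f \<in> homog n j"
    with that have "f \<in> homog n (Suc (j - 1))" by simp
    then show "f \<in> tail n e"
      by (rule homog_Suc_induct)
         (auto intro: subspace_gen_ideal gen_ideal_mult' tail_Var homog_polyring)
  qed
  show "\<exists>h\<in>homog n i. f - y ^ (tail_deg n e - 2 * i) * h \<in> tail n e"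
    if "2 * i \<le> tail_deg n e" "f \<in> homog n (tail_deg n e - i)" for i f
    using that by (intro bexI [of _ f]) (auto simp: tail_deg_def)
qed

text \<open>The induction needs the same form for all later tails and also for decreased exponents.
  Going down, x_m lies in the tails beyond \<open>m\<close>, so its coefficient is free to avoid the
  exceptions for the d_m + 1 new ideals.\<close>

lemma Surj_exists:
  assumes "m \<le> n"
  shows "\<exists>s. \<forall>l e. m \<le> l \<longrightarrow> l \<le> n \<longrightarrow> e \<le> d l \<longrightarrow> Surj n (tail l e) (lin n s) (tail_deg l e)"
  using assms
proof (induction rule: inc_induct)
  case base
  show ?case using Surj_last by (metis le_antisym)
next
  case (step m)
  then obtain s where s: "\<And>l e. m < l \<Longrightarrow> l \<le> n \<Longrightarrow> e \<le> d l \<Longrightarrow>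
      Surj n (tail l e) (lin n s) (tail_deg l e)"
    by (auto simp: Suc_le_eq)
  have upd: "Surj n (tail l e) (lin n (s(m := t))) (tail_deg l e)"
    if l: "m < l" "l \<le> n" "e \<le> d l" for l e t
  proof (rule Surj_cong [OF s [OF l]])
    have "lin n s - lin n (s(m := t)) = Const (s m - t) * Var m"
      using lin_upd [of m n s "s m"] lin_upd [of m n s t] step by (simp add: Const_diff algebra_simps)
    then show "lin n s - lin n (s(m := t)) \<in> tail l e"
      using l by (auto intro!: gen_ideal_Const tail_Var)
  qed simp_all
  let ?y = "lin n (s(m := 0))"
  have "\<exists>F. finite F \<and> (\<forall>u. u \<notin> F \<longrightarrow>
      Surj n (tail m e) (?y + Const (inverse u) * Var m) (tail_deg m e))" if "e \<in> {..d m}" for e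
    using step upd by (intro Surj_generic lin_homog) auto
  then obtain F where F: "finite F" "\<forall>u. u \<notin> F \<longrightarrow> (\<forall>e\<in>{..d m}.
      Surj n (tail m e) (?y + Const (inverse u) * Var m) (tail_deg m e))"
    using finite_exceptions [of "{..d m}" "\<lambda>e u. Surj n (tail m e) (?y + Const (inverse u) * Var m) (tail_deg m e)"]
    by auto
  obtain u where u: "u \<notin> F"
    using ex_new_if_finite [OF infinite_UNIV_char_0 F(1)] by blast
  have "Surj n (tail l e) (lin n (s(m := inverse u))) (tail_deg l e)"
    if "m \<le> l" "l \<le> n" "e \<le> d l" for l e
  proof (cases "l = m")
    case True
    then show ?thesis
      using F(2) u that step by (auto simp: lin_upd [of m n s "inverse u"])
  qed (use that upd in auto)
  then show ?case by blast
qed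

end

section \<open>Evaluation homomorphisms and substitution\<close>

locale coeff_hom =
  fixes h :: "'k::comm_ring_1 \<Rightarrow> 'b::comm_ring_1" and \<sigma> :: "nat \<Rightarrow> 'b"
  assumes h_add: "h (a + b) = h a + h b" and h_mult: "h (a * b) = h a * h b" and h_1: "h 1 = 1"
begin

lemma h_0 [simp]: "h 0 = 0"
  using h_add [of 0 0] by simp

definition mono_eval :: "(nat \<Rightarrow>\<^sub>0 nat) \<Rightarrow> 'b" where
  "mono_eval m = (\<Prod>i\<in>Poly_Mapping.keys m. \<sigma> i ^ Poly_Mapping.lookup m i)"

definition eval_mp :: "'k mpoly \<Rightarrow> 'b" where
  "eval_mp p = (\<Sum>m\<in>Poly_Mapping.keys p. h (Poly_Mapping.lookup p m) * mono_eval m)"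

lemma mono_eval_superset:
  assumes "finite S" "Poly_Mapping.keys m \<subseteq> S"
  shows "mono_eval m = (\<Prod>i\<in>S. \<sigma> i ^ Poly_Mapping.lookup m i)"
  unfolding mono_eval_def using assms
  by (intro prod.mono_neutral_left) (auto simp: in_keys_iff)

lemma mono_eval_add: "mono_eval (m + m') = mono_eval m * mono_eval m'"
proof -
  let ?S = "Poly_Mapping.keys m \<union> Poly_Mapping.keys m'"
  have "mono_eval (m + m') = (\<Prod>i\<in>?S. \<sigma> i ^ Poly_Mapping.lookup (m + m') i)"
    by (rule mono_eval_superset) (auto simp: keys_add_nat)
  then show ?thesis
    by (simp add: lookup_add power_add prod.distrib mono_eval_superset [of ?S m]
        mono_eval_superset [of ?S m'])
qed

lemma eval_superset:
  assumes "finite S" "Poly_Mapping.keys p \<subseteq> S"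
  shows "eval_mp p = (\<Sum>m\<in>S. h (Poly_Mapping.lookup p m) * mono_eval m)"
  unfolding eval_mp_def using assms
  by (intro sum.mono_neutral_left) (auto simp: in_keys_iff)

lemma eval_add: "eval_mp (p + q) = eval_mp p + eval_mp q"
proof -
  let ?S = "Poly_Mapping.keys p \<union> Poly_Mapping.keys q"
  have "eval_mp (p + q) = (\<Sum>m\<in>?S. h (Poly_Mapping.lookup (p + q) m) * mono_eval m)"
    by (rule eval_superset) (use keys_add [of p q] in auto)
  then show ?thesis
    by (simp add: lookup_add h_add distrib_right sum.distrib eval_superset [of ?S p]
        eval_superset [of ?S q])
qed

lemma eval_0 [simp]: "eval_mp 0 = 0"
  by (simp add: eval_mp_def)

lemma eval_sum: "eval_mp (\<Sum>x\<in>X. f x) = (\<Sum>x\<in>X. eval_mp (f x))"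
  by (induction X rule: infinite_finite_induct) (simp_all add: eval_add)

lemma eval_diff: "eval_mp (p - q) = eval_mp p - eval_mp q"
  using eval_add [of "p - q" q] by simp

lemma eval_single: "eval_mp (Poly_Mapping.single m c) = h c * mono_eval m"
  by (simp add: eval_mp_def)

lemma eval_mult: "eval_mp (p * q) = eval_mp p * eval_mp q"
proof -
  have "p * q = (\<Sum>m\<in>Poly_Mapping.keys p. \<Sum>m'\<in>Poly_Mapping.keys q.
      Poly_Mapping.single (m + m') (Poly_Mapping.lookup p m * Poly_Mapping.lookup q m'))"
    by (subst mpoly_sum_single [of p], subst mpoly_sum_single [of q])
       (simp add: sum_product mult_single)
  then have "eval_mp (p * q) = (\<Sum>m\<in>Poly_Mapping.keys p. \<Sum>m'\<in>Poly_Mapping.keys q.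
      (h (Poly_Mapping.lookup p m) * mono_eval m) * (h (Poly_Mapping.lookup q m') * mono_eval m'))"
    by (simp add: eval_sum eval_single h_mult mono_eval_add mult_ac)
  then show ?thesis by (simp add: eval_mp_def sum_product)
qed

lemma eval_Const [simp]: "eval_mp (Const c) = h c"
  by (simp add: Const_def eval_single mono_eval_def)

lemma eval_Var [simp]: "eval_mp (Var i) = \<sigma> i"
  by (simp add: Var_def eval_single mono_eval_def h_1)

lemma eval_power: "eval_mp (p ^ k) = eval_mp p ^ k"
  using eval_Const [of 1] by (induction k) (simp_all add: eval_mult h_1)

lemma eval_lin: "eval_mp (lin n s) = (\<Sum>i<n. h (s i) * \<sigma> i)"
  by (simp add: lin_def eval_sum eval_mult)

end

lemma Const_prod_Var:
  "Poly_Mapping.single m c = Const c * (\<Prod>i\<in>Poly_Mapping.keys m. Var i ^ Poly_Mapping.lookup m i)"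
proof -
  have pow: "Var i ^ k = Poly_Mapping.single (Poly_Mapping.single i k) (1::'a)" for i k
    by (induction k) (simp_all add: Var_def mult_single single_add [symmetric])
  have "(\<Prod>i\<in>S. Var i ^ f i) = Poly_Mapping.single (\<Sum>i\<in>S. Poly_Mapping.single i (f i)) (1::'a)" for S f
    by (induction S rule: infinite_finite_induct) (simp_all add: pow mult_single)
  moreover have "(\<Sum>i\<in>Poly_Mapping.keys m. Poly_Mapping.single i (Poly_Mapping.lookup m i)) = m"
    by (rule poly_mapping_eqI) (auto simp: lookup_sum lookup_single when_def in_keys_iff)
  ultimately show ?thesis by (simp add: Const_def mult_single)
qed

text \<open>Congruence is multiplicative on products of powers of variables and extends linearly. It
  serves to eliminate a variable by means of a linear form in the ideal.\<close>

lemma substitution_cong: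
  fixes \<sigma> :: "nat \<Rightarrow> 'k::comm_ring_1 mpoly"
  assumes \<sigma>: "\<And>i. i < n \<Longrightarrow> \<sigma> i \<in> polyring n" "\<And>i. i < n \<Longrightarrow> Var i - \<sigma> i \<in> gen_ideal n g"
    and p: "p \<in> polyring n"
  shows "coeff_hom.eval_mp Const \<sigma> p \<in> polyring n" "p - coeff_hom.eval_mp Const \<sigma> p \<in> gen_ideal n g"
proof -
  interpret coeff_hom Const \<sigma>
    by unfold_locales (simp_all add: Const_add Const_mult)
  have mono: "(\<Prod>i\<in>S. \<sigma> i ^ f i) \<in> polyring n \<and> (\<Prod>i\<in>S. Var i ^ f i) \<in> polyring n \<and>
      (\<Prod>i\<in>S. Var i ^ f i) - (\<Prod>i\<in>S. \<sigma> i ^ f i) \<in> gen_ideal n g"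
    if "finite S" "S \<subseteq> {..<n}" for S f
    using that
  proof (induction S)
    case (insert i S)
    let ?V = "\<Prod>i\<in>S. Var i ^ f i" and ?s = "\<Prod>i\<in>S. \<sigma> i ^ f i"
    have i: "Var i ^ f i \<in> polyring n" "\<sigma> i ^ f i \<in> polyring n"
      using insert.prems \<sigma> by (auto intro: polyring_power)
    have "Var i ^ f i - \<sigma> i ^ f i \<in> gen_ideal n g"
      using insert.prems \<sigma> by (intro power_diff_gen_ideal) auto
    then have "Var i ^ f i * (?V - ?s) + (Var i ^ f i - \<sigma> i ^ f i) * ?s \<in> gen_ideal n g"
      using insert i by (intro gen_ideal_add gen_ideal_mult gen_ideal_mult') auto
    then have "Var i ^ f i * ?V - \<sigma> i ^ f i * ?s \<in> gen_ideal n g"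
      by (simp add: algebra_simps)
    with insert i show ?case by (auto intro: polyring_mult)
  qed simp
  let ?m = "\<lambda>m. Poly_Mapping.single m (Poly_Mapping.lookup p m)"
  have "eval_mp (?m m) \<in> polyring n \<and> ?m m - eval_mp (?m m) \<in> gen_ideal n g"
    if "m \<in> Poly_Mapping.keys p" for m
  proof -
    have "Poly_Mapping.keys m \<subseteq> {..<n}" using p that by (auto simp: polyring_def)
    moreover have "eval_mp (?m m) =
        Const (Poly_Mapping.lookup p m) * (\<Prod>i\<in>Poly_Mapping.keys m. \<sigma> i ^ Poly_Mapping.lookup m i)"
      by (simp add: eval_single mono_eval_def)
    ultimately show ?thesis
      using mono [of "Poly_Mapping.keys m" "Poly_Mapping.lookup m"]
      unfolding Const_prod_Var [of m "Poly_Mapping.lookup p m"]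
      by (auto simp: right_diff_distrib [symmetric] intro: polyring_mult gen_ideal_Const)
  qed
  moreover have "eval_mp p = (\<Sum>m\<in>Poly_Mapping.keys p. eval_mp (?m m))"
    by (subst mpoly_sum_single [of p]) (simp add: eval_sum)
  moreover have "p - eval_mp p = (\<Sum>m\<in>Poly_Mapping.keys p. ?m m - eval_mp (?m m))"
    unfolding sum_subtractf using mpoly_sum_single [of p] calculation by simp
  ultimately show "eval_mp p \<in> polyring n" "p - eval_mp p \<in> gen_ideal n g"
    by (auto intro: polyring_sum gen_ideal_sum)
qed

section \<open>Exchange of a generator and regular elements\<close>

lemma gen_ideal_cong:
  assumes "\<And>i. i < n \<Longrightarrow> g i = h i"
  shows "gen_ideal n g = gen_ideal n h"
proof -
  have "(\<Sum>i<n. q i * g i) = (\<Sum>i<n. q i * h i)" for q using assms by (intro sum.cong) auto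
  then show ?thesis by (simp add: gen_ideal_def)
qed

text \<open>The generator 0 marks a free slot, so \<open>g\<close> stands for the ideal of the
  remaining generators.\<close>

lemma gen_ideal_upd_iff:
  assumes "i < n" "g i = 0"
  shows "f \<in> gen_ideal n (g(i := l)) \<longleftrightarrow> (\<exists>r\<in>polyring n. f - r * l \<in> gen_ideal n g)"
proof
  assume "f \<in> gen_ideal n (g(i := l))"
  then obtain u where u: "\<forall>j<n. u j \<in> polyring n" "f = (\<Sum>j<n. u j * (g(i := l)) j)"
    by (auto simp: gen_ideal_def)
  have "f - u i * l = (\<Sum>j<n. u j * g j)"
    using assms by (simp add: u(2) sum.remove [of "{..<n}" i])
  with u(1) have "f - u i * l \<in> gen_ideal n g" by (auto simp: gen_ideal_def)
  with u(1) assms(1) show "\<exists>r\<in>polyring n. f - r * l \<in> gen_ideal n g" by blast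
next
  assume "\<exists>r\<in>polyring n. f - r * l \<in> gen_ideal n g"
  then obtain r where r: "r \<in> polyring n" "f - r * l \<in> gen_ideal n g" by blast
  have "gen_ideal n g \<subseteq> gen_ideal n (g(i := l))"
  proof (rule gen_ideal_mono)
    fix j assume "j < n"
    then show "g j \<in> gen_ideal n (g(i := l))"
      using gen_ideal_gen [of j n "g(i := l)"] assms(2) by (cases "j = i") auto
  qed
  moreover have "r * l \<in> gen_ideal n (g(i := l))"
    using gen_ideal_gen [of i n "g(i := l)"] assms(1) r(1) by (auto intro: gen_ideal_mult)
  ultimately have "f - r * l + r * l \<in> gen_ideal n (g(i := l))"
    using r(2) by (intro gen_ideal_add) auto
  then show "f \<in> gen_ideal n (g(i := l))" by simp
qed

definition nzd :: "nat \<Rightarrow> 'k::comm_ring_1 mpoly \<Rightarrow> (nat \<Rightarrow> 'k mpoly) \<Rightarrow> bool" where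
  "nzd n x g \<longleftrightarrow> (\<forall>f\<in>polyring n. x * f \<in> gen_ideal n g \<longrightarrow> f \<in> gen_ideal n g)"

lemma nzdD: "nzd n x g \<Longrightarrow> f \<in> polyring n \<Longrightarrow> x * f \<in> gen_ideal n g \<Longrightarrow> f \<in> gen_ideal n g"
  by (simp add: nzd_def)

lemma nzd_cong: "(\<And>i. i < n \<Longrightarrow> g i = h i) \<Longrightarrow> nzd n x g \<longleftrightarrow> nzd n x h"
  using gen_ideal_cong [of n g h] by (simp add: nzd_def)

lemma nzd_power_mult:
  assumes "nzd n x g" "nzd n l g" "x \<in> polyring n" "l \<in> polyring n"
  shows "nzd n (x ^ k * l) g"
proof (induction k)
  case (Suc k)
  show ?case
    unfolding nzd_def
  proof (intro ballI impI)
    fix f assume f: "f \<in> polyring n" "x ^ Suc k * l * f \<in> gen_ideal n g"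
    have "x * (x ^ k * l * f) \<in> gen_ideal n g" using f(2) by (simp add: mult.assoc)
    then have "x ^ k * l * f \<in> gen_ideal n g"
      by (rule nzdD [OF assms(1), rotated]) (use assms f in \<open>auto intro: polyring_intros\<close>)
    then show "f \<in> gen_ideal n g" by (rule nzdD [OF Suc f(1)])
  qed
qed (use assms in simp)

text \<open>If x f = r l m modulo \<open>g\<close>, regularity modulo l gives f = s l; cancelling l
  gives x s = r m, and regularity modulo m gives s = t m.\<close>

lemma nzd_product:
  assumes i: "i < n" "g i = 0"
    and nzd: "nzd n x (g(i := l))" "nzd n x (g(i := m))" "nzd n l g"
    and R: "l \<in> polyring n" "m \<in> polyring n" "x \<in> polyring n"
  shows "nzd n x (g(i := l * m))"
  unfolding nzd_def
proof (intro ballI impI)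
  fix f assume f: "f \<in> polyring n" "x * f \<in> gen_ideal n (g(i := l * m))"
  from f(2) obtain r where r: "r \<in> polyring n" "x * f - r * (l * m) \<in> gen_ideal n g"
    using gen_ideal_upd_iff [where g = g, OF i] by blast
  have "x * f - (r * m) * l \<in> gen_ideal n g" using r(2) by (simp add: mult_ac)
  then have "x * f \<in> gen_ideal n (g(i := l))"
    using gen_ideal_upd_iff [where g = g and f = "x * f" and l = l, OF i] r R by (blast intro: polyring_mult)
  from nzdD [OF nzd(1) f(1) this] obtain s where
    s: "s \<in> polyring n" "f - s * l \<in> gen_ideal n g"
    using gen_ideal_upd_iff [where g = g, OF i] by blast
  have "(x * f - r * (l * m)) - x * (f - s * l) \<in> gen_ideal n g"
    by (intro gen_ideal_diff r gen_ideal_mult s R)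
  then have "l * (x * s - r * m) \<in> gen_ideal n g" by (simp add: algebra_simps)
  then have "x * s - r * m \<in> gen_ideal n g"
    by (rule nzdD [OF nzd(3), rotated]) (intro polyring_intros R r s)
  then have "x * s \<in> gen_ideal n (g(i := m))"
    using gen_ideal_upd_iff [where g = g and f = "x * s" and l = m, OF i] r by blast
  from nzdD [OF nzd(2) s(1) this] obtain t where
    t: "t \<in> polyring n" "s - t * m \<in> gen_ideal n g"
    using gen_ideal_upd_iff [where g = g, OF i] by blast
  have "(f - s * l) + l * (s - t * m) \<in> gen_ideal n g"
    by (intro gen_ideal_add s gen_ideal_mult t R)
  then have "f - t * (l * m) \<in> gen_ideal n g" by (simp add: algebra_simps)
  with t(1) show "f \<in> gen_ideal n (g(i := l * m))"
    using gen_ideal_upd_iff [where g = g and f = f and l = "l * m", OF i] by blast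
qed

lemma lin_eq_0: "lin n s = 0 \<Longrightarrow> k < n \<Longrightarrow> s k = 0"
proof -
  assume "lin n s = 0" "k < n"
  have "Poly_Mapping.lookup (lin n s) (Poly_Mapping.single k 1) = (\<Sum>i<n. if i = k then s i else 0)"
    unfolding lin_def lookup_sum
  proof (intro sum.cong refl)
    fix i
    have "Poly_Mapping.single i (1::nat) = Poly_Mapping.single k 1 \<longleftrightarrow> i = k"
      by (metis lookup_single_eq lookup_single_not_eq zero_neq_one)
    then show "Poly_Mapping.lookup (Const (s i) * Var i) (Poly_Mapping.single k 1) =
        (if i = k then s i else 0)"
      by (simp add: Const_def Var_def mult_single lookup_single when_def)
  qed
  with \<open>lin n s = 0\<close> \<open>k < n\<close> show "s k = 0" by simp
qed

lemma lin_zero: "lin n (\<lambda>_. 0) = 0"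
  by (simp add: lin_def)

text \<open>Modulo linear forms a polynomial ring is again a polynomial ring, hence a domain. The
  forms are removed one at a time by eliminating a variable.\<close>

lemma nzd_lin:
  fixes c :: "nat \<Rightarrow> nat \<Rightarrow> 'k::field"
  assumes "finite S" "S \<subseteq> {..<n}" "\<nexists>w. \<forall>k<n. b k = (\<Sum>i\<in>S. w i * c i k)"
  shows "nzd n (lin n b) (\<lambda>i. if i \<in> S then lin n (c i) else 0)"
  using assms
proof (induction S arbitrary: b c)
  case empty
  then have "lin n b \<noteq> 0" using lin_eq_0 by fastforce
  then show ?case by (auto simp: nzd_def gen_ideal_def)
next
  case (insert j S)
  let ?g = "\<lambda>i. if i \<in> insert j S then lin n (c i) else 0"
  have j: "j < n" using insert.prems by auto
  show ?case
  proof (cases "\<forall>k<n. c j k = 0")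
    case True
    have "lin n (c j) = 0" using True by (simp add: lin_def)
    then have "?g = (\<lambda>i. if i \<in> S then lin n (c i) else 0)" by auto
    moreover have "\<nexists>w. \<forall>k<n. b k = (\<Sum>i\<in>S. w i * c i k)"
    proof
      assume "\<exists>w. \<forall>k<n. b k = (\<Sum>i\<in>S. w i * c i k)"
      then obtain w where "\<forall>k<n. b k = (\<Sum>i\<in>S. w i * c i k)" by blast
      then have "\<forall>k<n. b k = (\<Sum>i\<in>insert j S. w i * c i k)"
        using True insert.hyps by simp
      with insert.prems show False by blast
    qed
    ultimately show ?thesis using insert.IH [of b c] insert.prems by auto
  next
    case False
    then obtain p where p: "p < n" "c j p \<noteq> 0" by blast
    define red where "red s = (\<lambda>k. s k - s p / c j p * c j k)" for s
    \<comment> \<open>The form with coefficients \<open>c j\<close> is solved for the variable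
      \<open>p\<close>. This substitution acts on coefficient vectors as \<open>red\<close> and
      sends that form to 0.\<close>
    define \<sigma> where "\<sigma> = Var(p := Var p - Const (inverse (c j p)) * lin n (c j))"
    interpret ev: coeff_hom Const \<sigma>
      by unfold_locales (simp_all add: Const_add Const_mult)
    have ev_lin: "ev.eval_mp (lin n s) = lin n (red s)" for s
    proof -
      have "ev.eval_mp (lin n s) =
          lin n s - Const (s p) * (Const (inverse (c j p)) * lin n (c j))"
        using p(1) unfolding ev.eval_lin
        by (simp add: \<sigma>_def lin_def sum.remove [of "{..<n}" p] right_diff_distrib)
      also have "\<dots> = lin n (red s)"
        unfolding red_def lin_diff by (simp add: lin_scale Const_mult divide_inverse mult.assoc)
      finally show ?thesis .
    qed
    have cj: "lin n (c j) \<in> gen_ideal n ?g"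
      using gen_ideal_gen [of j n ?g] j by simp
    have \<sigma>R: "\<sigma> i \<in> polyring n" "Var i - \<sigma> i \<in> gen_ideal n ?g" if "i < n" for i
      using that p cj by (auto simp: \<sigma>_def intro!: polyring_intros gen_ideal_Const)
    let ?g' = "\<lambda>i. if i \<in> S then lin n (red (c i)) else 0"
    have "red (c j) = (\<lambda>k. 0)" using p by (auto simp: red_def)
    then have ev_g: "ev.eval_mp (?g i) = ?g' i" for i
      using insert.hyps by (auto simp: ev_lin lin_zero)
    have indep: "\<nexists>w. \<forall>k<n. red b k = (\<Sum>i\<in>S. w i * red (c i) k)"
    proof
      assume "\<exists>w. \<forall>k<n. red b k = (\<Sum>i\<in>S. w i * red (c i) k)"
      then obtain w where w: "\<And>k. k < n \<Longrightarrow> red b k = (\<Sum>i\<in>S. w i * red (c i) k)" by blast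
      define w' where "w' = w(j := b p / c j p - (\<Sum>i\<in>S. w i * (c i p / c j p)))"
      have "b k = (\<Sum>i\<in>insert j S. w' i * c i k)" if "k < n" for k
      proof -
        have "(\<Sum>i\<in>S. w' i * c i k) = (\<Sum>i\<in>S. w i * c i k)"
          using insert.hyps by (intro sum.cong) (auto simp: w'_def)
        moreover have "b k = b p / c j p * c j k + (\<Sum>i\<in>S. w i * red (c i) k)"
          using w [OF that] by (simp add: red_def algebra_simps)
        moreover have "(\<Sum>i\<in>S. w i * red (c i) k) =
            (\<Sum>i\<in>S. w i * c i k) - (\<Sum>i\<in>S. w i * (c i p / c j p)) * c j k"
          by (simp add: red_def right_diff_distrib sum_subtractf sum_distrib_right mult.assoc)
        ultimately show ?thesis
          using insert.hyps by (simp add: w'_def [THEN fun_cong, of j] algebra_simps)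
      qed
      with insert.prems show False by blast
    qed
    show ?thesis
      unfolding nzd_def
    proof (intro ballI impI)
      fix f assume f: "f \<in> polyring n" "lin n b * f \<in> gen_ideal n ?g"
      then obtain u where u: "\<forall>i<n. u i \<in> polyring n" "lin n b * f = (\<Sum>i<n. u i * ?g i)"
        by (auto simp: gen_ideal_def)
      have "ev.eval_mp (lin n b * f) = (\<Sum>i<n. ev.eval_mp (u i) * ?g' i)"
        unfolding u(2) ev.eval_sum ev.eval_mult ev_g ..
      then have prod: "lin n (red b) * ev.eval_mp f \<in> gen_ideal n ?g'"
        using substitution_cong(1) [OF \<sigma>R] u(1)
        unfolding ev.eval_mult ev_lin gen_ideal_def
        by (intro CollectI exI [of _ "\<lambda>i. ev.eval_mp (u i)"]) simp
      have "nzd n (lin n (red b)) ?g'"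
        using insert.IH [OF _ indep] insert.prems by simp
      from nzdD [OF this substitution_cong(1) [OF \<sigma>R f(1)] prod]
      have "ev.eval_mp f \<in> gen_ideal n ?g'" .
      moreover have "gen_ideal n ?g' \<subseteq> gen_ideal n ?g"
      proof (rule gen_ideal_mono)
        fix i assume i: "i < n"
        have "lin n (red (c i)) \<in> gen_ideal n ?g" if "i \<in> S"
          unfolding red_def lin_diff lin_scale
          using gen_ideal_gen [of i n ?g] i that cj by (intro gen_ideal_diff gen_ideal_Const) auto
        then show "?g' i \<in> gen_ideal n ?g" by simp
      qed
      ultimately have "ev.eval_mp f \<in> gen_ideal n ?g" by blast
      with substitution_cong(2) [OF \<sigma>R f(1)] show "f \<in> gen_ideal n ?g"
        using gen_ideal_cancel_add by blast
    qed
  qed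
qed

text \<open>Gaussian elimination: equation \<open>i0\<close> is solved for an unknown occurring in
  it, leaving one equation and one unknown fewer.\<close>

lemma homogeneous_system_nontrivial:
  fixes c :: "'i \<Rightarrow> 'j \<Rightarrow> 'k::field"
  assumes "finite I" "finite V" "card I < card V"
  shows "\<exists>v. (\<exists>j\<in>V. v j \<noteq> 0) \<and> (\<forall>i\<in>I. (\<Sum>j\<in>V. c i j * v j) = 0)"
  using assms
proof (induction I arbitrary: V c)
  case empty
  then have "V \<noteq> {}" by auto
  then show ?case by (intro exI [of _ "\<lambda>_. 1"]) auto
next
  case (insert i0 I)
  show ?case
  proof (cases "\<forall>j\<in>V. c i0 j = 0")
    case True
    with insert.IH [of V c] insert show ?thesis by auto
  next
    case False
    then obtain j0 where j0: "j0 \<in> V" "c i0 j0 \<noteq> 0" by blast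
    let ?V = "V - {j0}"
    have "finite ?V" "card I < card ?V" using insert j0 by auto
    from insert.IH [OF this, of "\<lambda>i j. c i j - c i j0 * c i0 j / c i0 j0"]
    obtain v where v: "\<exists>j\<in>?V. v j \<noteq> 0"
      "\<And>i. i \<in> I \<Longrightarrow> (\<Sum>j\<in>?V. (c i j - c i j0 * c i0 j / c i0 j0) * v j) = 0"
      by blast
    define w where "w = v(j0 := - (\<Sum>j\<in>?V. c i0 j * v j) / c i0 j0)"
    have w: "(\<Sum>j\<in>V. c i j * w j) = c i j0 * w j0 + (\<Sum>j\<in>?V. c i j * v j)" for i
      using insert.prems j0 by (simp add: sum.remove [of V j0] w_def)
    have "(\<Sum>j\<in>V. c i j * w j) = 0" if "i \<in> I" for i
    proof -
      have "(\<Sum>j\<in>?V. c i j * v j) = c i j0 / c i0 j0 * (\<Sum>j\<in>?V. c i0 j * v j)"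
        using v(2) [OF that] by (simp add: left_diff_distrib sum_subtractf sum_distrib_left mult.assoc)
      then show ?thesis by (simp add: w) (simp add: w_def)
    qed
    moreover have "(\<Sum>j\<in>V. c i0 j * w j) = 0"
      using j0 by (simp add: w) (simp add: w_def)
    moreover have "\<exists>j\<in>V. w j \<noteq> 0" using v(1) by (auto simp: w_def)
    ultimately show ?thesis by (intro exI [of _ w]) auto
  qed
qed

section \<open>Regularity, socle and the strong Lefschetz property\<close>

context hessenberg
begin

text \<open>Both exponents vary independently so that either kind of factor can be split off; the
  slots outside \<open>S\<close> are free.\<close>

definition prod_gens :: "nat set \<Rightarrow> (nat \<Rightarrow> nat) \<Rightarrow> (nat \<Rightarrow> nat) \<Rightarrow> nat \<Rightarrow> 'k mpoly" where
  "prod_gens S p q i = (if i \<in> S then Var i ^ p i * lin n (A i) ^ q i else 0)"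

text \<open>Some nonzero v is annihilated by the other n - 1 forms. If the remaining one depended on
  them, it would annihilate v too, so v_i (A v)_i = 0 for all i, against
  \<open>nonzero\<close>.\<close>

lemma choice_independent:
  assumes c: "\<And>i. i < n \<Longrightarrow> c i = (\<lambda>j. if j = i then 1 else 0) \<or> c i = A i" and k: "k < n"
    and S: "S \<subseteq> {..<n} - {k}"
  shows "\<nexists>w. \<forall>j<n. c k j = (\<Sum>i\<in>S. w i * c i j)"
proof
  assume "\<exists>w. \<forall>j<n. c k j = (\<Sum>i\<in>S. w i * c i j)"
  then obtain w where w: "\<And>j. j < n \<Longrightarrow> c k j = (\<Sum>i\<in>S. w i * c i j)" by blast
  obtain v where v: "\<exists>j<n. v j \<noteq> 0" "\<And>i. i \<in> {..<n} - {k} \<Longrightarrow> (\<Sum>j<n. c i j * v j) = 0"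
    using homogeneous_system_nontrivial [of "{..<n} - {k}" "{..<n}" c] k by auto
  have "(\<Sum>j<n. c k j * v j) = (\<Sum>j<n. \<Sum>i\<in>S. w i * (c i j * v j))"
    by (simp add: w sum_distrib_right mult.assoc)
  also have "\<dots> = (\<Sum>i\<in>S. w i * (\<Sum>j<n. c i j * v j))"
    by (subst sum.swap) (simp add: sum_distrib_left)
  also have "\<dots> = 0" using v(2) S by (intro sum.neutral) auto
  finally have all: "(\<Sum>j<n. c i j * v j) = 0" if "i < n" for i
    using v(2) that by (cases "i = k") auto
  have "v i = 0 \<or> (\<Sum>j<n. A i j * v j) = 0" if "i < n" for i
    using c [OF that] all [OF that] that
    by (auto simp: if_distrib [where f = "\<lambda>x. x * _"] cong: if_cong)
  with v(1) nonzero show False by metis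
qed

text \<open>Regularity is reduced to the case of linear forms by splitting off one factor at a time.\<close>

lemma nzd_prod_gens:
  assumes "S \<subseteq> {..<n} - {k}" "k < n" "\<And>i. i \<in> S \<Longrightarrow> 0 < p i + q i"
    and "x = Var k \<or> x = lin n (A k)"
  shows "nzd n x (prod_gens S p q)"
  using assms
proof (induction "\<Sum>i\<in>S. p i + q i" arbitrary: S p q k x rule: less_induct)
  case less
  have finS: "finite S" using less.prems finite_subset by blast
  have x: "x \<in> polyring n" using less.prems by auto
  show ?case
  proof (cases "\<exists>i\<in>S. 1 < p i + q i")
    case True
    then obtain i where i: "i \<in> S" "1 < p i + q i" by blast
    then have in': "i < n" using less.prems by auto
    \<comment> \<open>The exponents \<open>p''\<close> and \<open>q''\<close> display the split
      factor \<open>l\<close> in the same product shape, so the induction hypothesis covers both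
      \<open>l\<close> and its cofactor.\<close>
    obtain l p' q' p'' q'' where l: "l = Var i \<or> l = lin n (A i)"
      "Var i ^ p i * lin n (A i) ^ q i = l * (Var i ^ p' * lin n (A i) ^ q')"
      "p' + q' + 1 = p i + q i" "l = Var i ^ p'' * lin n (A i) ^ q''" "p'' + q'' = 1"
    proof (cases "p i = 0")
      case True
      then show ?thesis using i that [of "lin n (A i)" 0 "q i - 1" 0 1]
        by (simp add: power_eq_if)
    next
      case False
      then show ?thesis using i that [of "Var i" "p i - 1" "q i" 1 0]
        by (simp add: power_eq_if mult.assoc)
    qed
    define m where "m = Var i ^ p' * lin n (A i) ^ q'"
    let ?g = "prod_gens (S - {i}) p q"
    have sumS: "(\<Sum>j\<in>S. (f(i := a)) j + (h(i := b)) j) = a + b + (\<Sum>j\<in>S - {i}. f j + h j)"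
      for f h :: "nat \<Rightarrow> nat" and a b
      using finS i(1) by (simp add: sum.remove [of S i])
    have sum0: "(\<Sum>j\<in>S. p j + q j) = p i + q i + (\<Sum>j\<in>S - {i}. p j + q j)"
      using finS i(1) by (rule sum.remove)
    have upd: "?g(i := Var i ^ a * lin n (A i) ^ b) = prod_gens S (p(i := a)) (q(i := b))" for a b
      using i(1) by (auto simp: prod_gens_def)
    have sub: "nzd n x (prod_gens S (p(i := a)) (q(i := b)))"
      if "a + b < p i + q i" "0 < a + b" for a b
      by (rule less.hyps [where S = S and k = k]) (use that less.prems sum0 sumS in auto)
    have "nzd n x (?g(i := l * m))"
    proof (rule nzd_product)
      show "nzd n x (?g(i := l))" unfolding l(4) upd by (rule sub) (use l i in auto)
      show "nzd n x (?g(i := m))" unfolding m_def upd by (rule sub) (use l i in auto)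
      show "nzd n l ?g"
        by (rule less.hyps [where S = "S - {i}" and k = i]) (use less.prems sum0 in' i l in auto)
    qed (use in' l x in \<open>auto simp: prod_gens_def m_def intro!: polyring_intros\<close>)
    moreover have "?g(i := l * m) = prod_gens S p q"
      unfolding m_def l(2) [symmetric] upd by simp
    ultimately show ?thesis by simp
  next
    case False
    \<comment> \<open>All products are single linear forms now; \<open>c\<close> collects their
      coefficient vectors, with that of \<open>x\<close> at \<open>k\<close>.\<close>
    define c where "c i = (if i = k then (if x = Var k then \<lambda>j. if j = i then 1 else 0 else A i)
      else if i \<in> S \<and> q i = 0 then \<lambda>j. if j = i then 1 else 0 else A i)" for i
    have one: "p i = 1 \<and> q i = 0 \<or> p i = 0 \<and> q i = 1" if "i \<in> S" for i
      using False less.prems(3) [OF that] that by (cases "p i"; cases "q i") auto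
    have Var_lin: "lin n (\<lambda>j. if j = i then 1 else 0) = Var i" if "i < n" for i
      using lin_unit [OF that, of 1] by simp
    have "nzd n (lin n (c k)) (\<lambda>i. if i \<in> S then lin n (c i) else 0)"
      by (rule nzd_lin [OF finS]) (use less.prems choice_independent [of c k S] in \<open>auto simp: c_def\<close>)
    moreover have "lin n (c k) = x"
      using less.prems by (auto simp: c_def Var_lin)
    moreover have "(\<lambda>i. if i \<in> S then lin n (c i) else 0) = prod_gens S p q"
    proof
      fix i
      have "lin n (c i) = Var i ^ p i * lin n (A i) ^ q i" if "i \<in> S"
        using one [OF that] that less.prems(1) by (auto simp: c_def Var_lin)
      then show "(if i \<in> S then lin n (c i) else 0) = prod_gens S p q i"
        by (simp add: prod_gens_def)
    qed
    ultimately show ?thesis by simp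
  qed
qed

text \<open>Let \<open>g\<close> be the generators without the one at \<open>m\<close>. Cancelling
  x_m shows that a socle element is s x_m^(e-1) l_m modulo the ideal. Cancelling this regular factor
  makes s a socle element of the next tail, in a degree lower by e, where induction applies.\<close>

lemma tail_socle:
  assumes "m \<le> n" "f \<in> homog n i" "i < tail_deg m (d m)"
    "\<And>k. k < n \<Longrightarrow> Var k * f \<in> tail m (d m)"
  shows "f \<in> tail m (d m)"
  using assms
proof (induction m arbitrary: f i rule: inc_induct)
  case base
  then show ?case by (simp add: tail_deg_def)
next
  case (step m)
  have m: "m < n" by (rule step.hyps)
  let ?e = "d m" and ?x = "Var m :: 'k mpoly" and ?l = "lin n (A m)"
  define g where "g = (tail_gens m ?e)(m := 0)"
  have e: "0 < ?e" using d_pos m by simp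
  have gm: "m < n" "g m = 0" using m by (simp_all add: g_def)
  have xl: "?x ^ ?e * ?l = ?x * (?x ^ (?e - 1) * ?l)"
    using e by (simp add: power_eq_if mult.assoc)
  have tail_iff: "f \<in> tail m ?e \<longleftrightarrow> (\<exists>r\<in>polyring n. f - r * (?x ^ ?e * ?l) \<in> gen_ideal n g)" for f
  proof -
    have "tail_gens m ?e = g(m := ?x ^ ?e * ?l)" by (auto simp: g_def tail_gens_def)
    then show ?thesis using gen_ideal_upd_iff [where g = g, OF gm, of f "?x ^ ?e * ?l"] by simp
  qed
  have next_iff: "f \<in> tail (Suc m) (d (Suc m)) \<longleftrightarrow> (\<exists>r\<in>polyring n. f - r * ?x \<in> gen_ideal n g)" for f
  proof -
    have "tail_gens (Suc m) (d (Suc m)) = g(m := ?x)" by (auto simp: g_def tail_gens_def)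
    then show ?thesis using gen_ideal_upd_iff [where g = g, OF gm, of f ?x] by simp
  qed
  have nzd: "nzd n x g" if "x = ?x \<or> x = ?l" for x
  proof -
    have "nzd n x (prod_gens ({..<n} - {m}) (\<lambda>i. if i < m then 1 else d i) (\<lambda>i. if i < m then 0 else 1))"
      by (rule nzd_prod_gens [of _ m]) (use m that in auto)
    then show ?thesis
      by (subst nzd_cong) (auto simp: prod_gens_def g_def tail_gens_def)
  qed
  have g_sub: "gen_ideal n g \<subseteq> tail m ?e"
    unfolding g_def
  proof (rule gen_ideal_mono)
    show "((tail_gens m ?e)(m := 0)) i \<in> tail m ?e" if "i < n" for i
      using gen_ideal_gen [OF that, of "tail_gens m ?e"] by simp
  qed
  have R: "f \<in> polyring n" using step.prems homog_polyring by blast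
  obtain r where r: "r \<in> polyring n" "?x * f - r * (?x ^ ?e * ?l) \<in> gen_ideal n g"
    using step.prems(3) [OF m] tail_iff by blast
  have "?x * (f - r * (?x ^ (?e - 1) * ?l)) \<in> gen_ideal n g"
    using r(2) unfolding xl by (simp add: algebra_simps)
  then have "f - r * (?x ^ (?e - 1) * ?l) \<in> gen_ideal n g"
    by (rule nzdD [OF nzd [of ?x], rotated 2]) (use R r m in \<open>auto intro!: polyring_intros\<close>)
  then have fr: "f - r * (?x ^ (?e - 1) * ?l) \<in> tail m ?e" using g_sub by blast
  have xl_hom: "?x ^ (?e - 1) * ?l \<in> homog n ?e"
    using homog_mult [OF homog_power1 [OF homog_Var [OF m], of "?e - 1"] lin_homog] e by simp
  define s where "s = (if ?e \<le> i then hcomp (i - ?e) r else 0)"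
  have "hcomp i (f - r * (?x ^ (?e - 1) * ?l)) \<in> tail m ?e"
    by (rule gen_ideal_hcomp [OF tail_gens_homog fr])
  moreover have "hcomp i (f - r * (?x ^ (?e - 1) * ?l)) = f - s * (?x ^ (?e - 1) * ?l)"
    unfolding hcomp_diff hcomp_homog [OF step.prems(1)] hcomp_mult_homog [OF r(1) xl_hom] s_def
    by simp
  ultimately have fs: "f - s * (?x ^ (?e - 1) * ?l) \<in> tail m ?e" by simp
  have "s * (?x ^ (?e - 1) * ?l) \<in> tail m ?e"
  proof (cases "?e \<le> i")
    case False
    then show ?thesis by (simp add: s_def)
  next
    case True
    have s: "s \<in> homog n (i - ?e)" using True r(1) by (simp add: s_def hcomp_in_homog)
    have sR: "s \<in> polyring n" using s homog_polyring by blast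
    have "Var k * s \<in> tail (Suc m) (d (Suc m))" if k: "k < n" for k
    proof -
      have "Var k * f - Var k * (f - s * (?x ^ (?e - 1) * ?l)) \<in> tail m ?e"
        using k by (intro gen_ideal_diff step.prems(3) gen_ideal_mult [OF fs]) auto
      then have "Var k * s * (?x ^ (?e - 1) * ?l) \<in> tail m ?e"
        by (simp add: algebra_simps)
      then obtain t where t: "t \<in> polyring n"
        "Var k * s * (?x ^ (?e - 1) * ?l) - t * (?x ^ ?e * ?l) \<in> gen_ideal n g"
        using tail_iff by blast
      have "(?x ^ (?e - 1) * ?l) * (Var k * s - t * ?x) \<in> gen_ideal n g"
        using t(2) unfolding xl by (simp add: algebra_simps)
      moreover have "nzd n (?x ^ (?e - 1) * ?l) g"
        using m by (intro nzd_power_mult nzd) auto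
      moreover have "Var k * s - t * ?x \<in> polyring n"
        using t k sR m by (intro polyring_intros) auto
      ultimately have "Var k * s - t * ?x \<in> gen_ideal n g"
        using nzdD by blast
      with t(1) show ?thesis using next_iff by blast
    qed
    moreover have "i - ?e < tail_deg (Suc m) (d (Suc m))"
      using step.prems(2) tail_deg_level [of m "Suc m" ?e] True m by (simp add: level_Suc)
    ultimately have "s \<in> tail (Suc m) (d (Suc m))"
      using step.IH [OF s] by blast
    then obtain t where t: "t \<in> polyring n" "s - t * ?x \<in> gen_ideal n g"
      using next_iff by blast
    have "(?x ^ (?e - 1) * ?l) * (s - t * ?x) \<in> gen_ideal n g"
      using m by (intro gen_ideal_mult t polyring_intros) auto
    then have "s * (?x ^ (?e - 1) * ?l) - t * (?x ^ ?e * ?l) \<in> gen_ideal n g"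
      unfolding xl by (simp add: algebra_simps)
    with t(1) show ?thesis using tail_iff by blast
  qed
  from gen_ideal_add [OF fs this] show ?case by simp
qed

text \<open>Gorenstein duality. By induction on \<open>k\<close> each x_i f lies in the ideal, and
  \<open>tail_socle\<close> applies because the degree of \<open>f\<close> is still below the socle
  degree.\<close>

lemma pairing_nondegenerate:
  assumes "k \<le> tail_deg 0 (d 0)" "f \<in> homog n (tail_deg 0 (d 0) - k)"
    "\<And>h. h \<in> homog n k \<Longrightarrow> f * h \<in> tail 0 (d 0)"
  shows "f \<in> tail 0 (d 0)"
  using assms
proof (induction k arbitrary: f)
  case 0
  from 0(3) [of 1] show ?case by simp
next
  case (Suc k)
  show ?case
  proof (rule tail_socle [OF _ Suc.prems(2)])
    show "Var i * f \<in> tail 0 (d 0)" if i: "i < n" for i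
    proof (rule Suc.IH)
      show "Var i * f \<in> homog n (tail_deg 0 (d 0) - k)"
        using Suc.prems(1) by (intro homog_mult' [OF homog_Var [OF i] Suc.prems(2)]) auto
      show "Var i * f * h \<in> tail 0 (d 0)" if "h \<in> homog n k" for h
        using Suc.prems(3) [of "Var i * h"] homog_mult [OF homog_Var [OF i] that]
        by (simp add: mult_ac)
    qed (use Suc.prems in auto)
  qed (use Suc.prems in auto)
qed

text \<open>All generators have positive degree. With the pairing this shows that the top degree
  does not vanish.\<close>

lemma one_notin_tail: "1 \<notin> tail 0 (d 0)"
proof
  assume "1 \<in> tail 0 (d 0)"
  then obtain u where u: "\<forall>i<n. u i \<in> polyring n" "1 = (\<Sum>i<n. u i * tail_gens 0 (d 0) i)"
    by (auto simp: gen_ideal_def)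
  have "hcomp 0 (u i * tail_gens 0 (d 0) i) = 0" if i: "i < n" for i
  proof -
    have "tail_gens 0 (d 0) i \<in> homog n (d i + 1)"
      using homog_mult [OF homog_power1 [OF homog_Var [OF i]] lin_homog, of "d i" "A i"]
      by (simp add: tail_gens_def)
    from hcomp_mult_homog [OF _ this, of "u i" 0] u(1) i show ?thesis by simp
  qed
  then have "hcomp 0 (1 :: 'k mpoly) = 0"
    by (subst u(2)) (simp add: hcomp_sum)
  moreover have "hcomp 0 (1 :: 'k mpoly) = 1"
    using hcomp_homog [OF homog_1 [of n], of 0] by simp
  ultimately show False by simp
qed

theorem SLP_tail: "SLP n (tail 0 (d 0))"
proof -
  let ?I = "tail 0 (d 0)" and ?c = "tail_deg 0 (d 0)"
  obtain s where S: "Surj n ?I (lin n s) ?c"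
    using Surj_exists [of 0] by auto
  let ?z = "lin n s"
  have top: "homog n j \<subseteq> ?I" if "?c < j" for j using S that by (auto simp: Surj_def)
  \<comment> \<open>Otherwise the pairing with k = c would put 1 into the ideal.\<close>
  have "\<exists>f\<in>homog n ?c. f \<notin> ?I"
    using pairing_nondegenerate [of ?c 1] one_notin_tail by auto
  then have socle: "socle_deg n ?I = ?c"
    unfolding socle_deg_def using top by (intro Greatest_equality) (auto simp: not_less [symmetric])
  \<comment> \<open>If z^e f vanishes, so does z^(c-2i) f. As z^(c-2i) maps onto degree c - i,
    \<open>f\<close> pairs to zero with that whole degree.\<close>
  have inj: "mult_inj n ?I ?z e i" if "2 * i + e \<le> ?c" for e i
    unfolding mult_inj_def
  proof (intro ballI impI)
    fix f assume f: "f \<in> homog n i" "?z ^ e * f \<in> ?I"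
    have "?c - 2 * i = (?c - 2 * i - e) + e" using that by simp
    then have eq: "?z ^ (?c - 2 * i) * f = ?z ^ (?c - 2 * i - e) * (?z ^ e * f)"
      by (metis mult.assoc power_add)
    have zf: "?z ^ (?c - 2 * i) * f \<in> ?I"
      unfolding eq by (rule gen_ideal_mult [OF f(2) polyring_power [OF lin_polyring]])
    show "f \<in> ?I"
    proof (rule pairing_nondegenerate [of "?c - i"])
      show "f \<in> homog n (?c - (?c - i))" using f that by simp
      fix h :: "'k mpoly" assume h: "h \<in> homog n (?c - i)"
      have "2 * i \<le> ?c" using that by simp
      with S h obtain h' where h': "h' \<in> homog n i" "h - ?z ^ (?c - 2 * i) * h' \<in> ?I"
        unfolding Surj_def by blast
      have "f * (h - ?z ^ (?c - 2 * i) * h') + h' * (?z ^ (?c - 2 * i) * f) \<in> ?I"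
        by (intro gen_ideal_add gen_ideal_mult [OF h'(2)] gen_ideal_mult [OF zf]
            homog_polyring [OF f(1)] homog_polyring [OF h'(1)])
      then show "f * h \<in> ?I" by (simp add: algebra_simps)
    qed simp
  qed
  \<comment> \<open>The symmetric power onto degree i + e contains z^e as a factor, so z^e is
    surjective as well.\<close>
  have surj: "mult_surj n ?I ?z e i" if "?c \<le> 2 * i + e" "i + e \<le> ?c" for e i
    unfolding mult_surj_def
  proof
    fix f :: "'k mpoly" assume f: "f \<in> homog n (i + e)"
    define j where "j = ?c - (i + e)"
    have j: "2 * j \<le> ?c" "i + e = ?c - j" "?c - 2 * j = e + (i - j)" "j \<le> i"
      using that by (auto simp: j_def)
    with S f obtain h where h: "h \<in> homog n j" "f - ?z ^ (?c - 2 * j) * h \<in> ?I"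
      unfolding Surj_def by metis
    have "?z ^ (i - j) * h \<in> homog n i"
      using j by (intro homog_power_mult [OF lin_homog h(1)]) auto
    moreover have "f - ?z ^ e * (?z ^ (i - j) * h) \<in> ?I"
      using h(2) unfolding j(3) power_add by (simp add: mult.assoc)
    ultimately show "\<exists>h\<in>homog n i. f - ?z ^ e * h \<in> ?I" by blast
  qed
  show ?thesis
    unfolding SLP_def Let_def socle
  proof (intro bexI allI impI)
    fix e i assume "1 \<le> e \<and> e \<le> ?c - 1 \<and> i \<le> ?c - e"
    then have "i + e \<le> ?c" by auto
    then show "mult_inj n ?I ?z e i \<or> mult_surj n ?I ?z e i"
      using inj [of i e] surj [of i e] by linarith
  qed (rule lin_homog)
qed

end

text \<open>Along the line spanned by a common zero of the generators, the quotient would surject onto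
  infinitely many powers of the parameter.\<close>

lemma artinian_no_common_zero:
  fixes g :: "nat \<Rightarrow> 'k::field mpoly"
  assumes art: "artinian_quot n (gen_ideal n g)" and i0: "i0 < n" "v i0 \<noteq> 0"
  shows "\<exists>i<n. coeff_hom.eval_mp (\<lambda>c. [:c:]) (\<lambda>i. [:0, v i:]) (g i) \<noteq> 0"
proof (rule ccontr)
  interpret ev: coeff_hom "\<lambda>c::'k. [:c:]" "\<lambda>i. [:0, v i:]"
    by unfold_locales simp_all
  assume "\<not> (\<exists>i<n. ev.eval_mp (g i) \<noteq> 0)"
  then have ideal: "ev.eval_mp p = 0" if "p \<in> gen_ideal n g" for p
    using that by (auto simp: gen_ideal_def ev.eval_sum ev.eval_mult)
  obtain B where B: "finite B" "\<forall>p\<in>polyring n. \<exists>c. p - (\<Sum>b\<in>B. Const (c b) * b) \<in> gen_ideal n g"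
    using art by (auto simp: artinian_quot_def)
  \<comment> \<open>This bounds the degree on the line of every combination of \<open>B\<close>, so
    the power \<open>Suc D\<close> is out of reach.\<close>
  define D where "D = (\<Sum>b\<in>B. Polynomial.degree (ev.eval_mp b))"
  have "Var i0 ^ Suc D \<in> polyring n" using i0 by (intro polyring_power) simp
  then obtain c where "Var i0 ^ Suc D - (\<Sum>b\<in>B. Const (c b) * b) \<in> gen_ideal n g"
    using B(2) by blast
  from ideal [OF this] have "[:0, v i0:] ^ Suc D = (\<Sum>b\<in>B. smult (c b) (ev.eval_mp b))"
    by (simp add: ev.eval_diff ev.eval_power ev.eval_sum ev.eval_mult del: power_Suc)
  moreover have "Polynomial.degree (\<Sum>b\<in>B. smult (c b) (ev.eval_mp b)) \<le> D"
  proof (intro degree_sum_le B(1))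
    fix b assume "b \<in> B"
    then have "Polynomial.degree (ev.eval_mp b) \<le> D"
      unfolding D_def using B(1) by (intro member_le_sum) auto
    then show "Polynomial.degree (smult (c b) (ev.eval_mp b)) \<le> D"
      using degree_smult_le order.trans by blast
  qed
  moreover have "Polynomial.degree ([:0, v i0:] ^ Suc D) = Suc D"
    using i0 by (subst degree_power_eq) auto
  ultimately show False by simp
qed

theorem theorem3p1:
  fixes n :: nat and d :: "nat \<Rightarrow> nat" and a :: "nat \<Rightarrow> nat \<Rightarrow> 'k::field_char_0"
  assumes "n \<ge> 1"
    and "\<forall>i<n. d i > 0"
    and "n \<ge> 2 \<longrightarrow> artinian_quot n (gen_ideal n (gens n d a))"
  shows "SLP n (gen_ideal n (gens n d a))"
proof -
  \<comment> \<open>For n = 1 the generator x^(d+1) is written as x^d times x, so the matrix is the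
    unit matrix. Otherwise the arbitrary values of \<open>a\<close> beyond the superdiagonal are cut
    off.\<close>
  define A :: "nat \<Rightarrow> nat \<Rightarrow> 'k" where
    "A i j = (if n = 1 then (if j = 0 then 1 else 0) else if j \<le> Suc i then a i j else 0)" for i j
  have lform: "lform n a i = lin n (A i)" if "n \<noteq> 1" "i < n" for i
  proof -
    have "lin n (A i) = (\<Sum>j\<in>{..min (i + 1) (n - 1)}. Const (A i j) * Var j)"
      unfolding lin_def using assms(1)
      by (intro sum.mono_neutral_right) (auto simp: A_def that)
    then show ?thesis using that by (auto simp: lform_def A_def intro!: sum.cong)
  qed
  have gens: "gens n d a i = Var i ^ d i * lin n (A i)" if "i < n" for i
  proof (cases "n = 1")
    case True
    then show ?thesis using that by (simp add: gens_def lin_def A_def mult.commute)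
  next
    case False
    then show ?thesis using that lform by (simp add: gens_def)
  qed
  interpret hessenberg n d A
  proof
    fix i and v :: "nat \<Rightarrow> 'k" assume i: "i < n" "v i \<noteq> 0"
    show "\<exists>i<n. v i \<noteq> 0 \<and> (\<Sum>j<n. A i j * v j) \<noteq> 0"
    proof (cases "n = 1")
      case True
      with i show ?thesis by (auto simp: A_def)
    next
      case False
      interpret ev: coeff_hom "\<lambda>c::'k. [:c:]" "\<lambda>i. [:0, v i:]"
        by unfold_locales simp_all
      have "artinian_quot n (gen_ideal n (gens n d a))" using False assms by simp
      from artinian_no_common_zero [of _ _ i v, OF this i] obtain j where
        j: "j < n" "ev.eval_mp (gens n d a j) \<noteq> 0" by blast
      \<comment> \<open>On the line through \<open>v\<close>, generator j becomes (v_j t)^(d_j)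
        times (A v)_j t. As d_j > 0, its not vanishing forces both v_j and (A v)_j to be
        nonzero.\<close>
      have "ev.eval_mp (lin n (A j)) = [:0, \<Sum>k<n. A j k * v k:]"
        unfolding ev.eval_lin by (induction n) (simp_all)
      with j assms(2) show ?thesis
        by (intro exI [of _ j]) (auto simp: gens ev.eval_mult ev.eval_power)
    qed
  qed (use assms in \<open>auto simp: A_def\<close>)
  have "gen_ideal n (gens n d a) = tail 0 (d 0)"
    by (rule gen_ideal_cong) (simp add: gens tail_gens_def)
  with SLP_tail show ?thesis by simp
qed

end
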